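(* Let $H:\mathbb{R}\to[0,\infty)$ be a symmetric convex function such that $H(x)=\tfrac14 x^2$ for $x\in[-2t_0,2t_0]$ for some $t_0>0$, and let $H^*:\mathbb{R}\to[0,\infty)$ be its Fenchel--Legendre transform, $H^*(x)=\sup_{y\in\mathbb{R}}\{xy-H(y)\}$. Suppose moreover that $\lim_{x\to\infty}H^*(x)/x=\infty$ and that there exist $A\in[1,\infty)$ and $\alpha\in(1,2]$ such that $$H(sx)\le A s^{\alpha}H(x)\quad\text{for all } x\in\mathbb{R},\ s\in[0,1].$$ Denote $\theta(t)=H^*(t)$ for $t\ge 0$. For a Borel probability measure $\mu$ on $\mathbb{R}$ the following conditions are equivalent. (i) For every $s>0$ we have $\int_{\mathbb{R}}e^{s|x|}\,d\mu(x)<\infty$, and there exists $c>0$ such that $$\operatorname{Ent}_\mu(e^{\varphi})\le\int_{\mathbb{R}}H(c\varphi')e^{\varphi}\,d\mu$$ for every smooth convex Lipschitz function $\varphi:\mathbb{R}\to\mathbb{R}$. (ii) There exists $b>0$ such that for all $h>0$, $$\Delta_\mu(h)\le\frac1b\,\theta^{-1}(t_0^2+h).$$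
   Context: For a non-negative function $g$, $\operatorname{Ent}_\mu(g)=\int g\ln g\,d\mu-\int g\,d\mu\,\ln\bigl(\int g\,d\mu\bigr)$ if $\int g\ln g\,d\mu<\infty$, and $\operatorname{Ent}_\mu(g)=\infty$ otherwise. Let $\tau$ be the symmetric exponential probability measure on $\mathbb{R}$ with density $\tfrac12e^{-|x|}$, $F_\tau$ its distribution function, $F_\mu(x)=\mu((-\infty,x])$, and $F_\mu^{-1}(t)=\inf\{y\in\mathbb{R}:F_\mu(y)\ge t\}\in\mathbb{R}\cup\{\pm\infty\}$ for $t\in[0,1]$. Let $U_\mu=F_\mu^{-1}\circ F_\tau$, i.e. $U_\mu(x)=F_\mu^{-1}(\tfrac12e^{-|x|})$ for $x<0$ and $U_\mu(x)=F_\mu^{-1}(1-\tfrac12e^{-|x|})$ for $x\ge0$ (the unique left-continuous non-decreasing map transporting $\tau$ onto $\mu$). For $h>0$, $\Delta_\mu(h)=\sup_{x\in\mathbb{R}}\{U_\mu(x+h)-U_\mu(x)\}$. $\theta^{-1}$ denotes the inverse of the increasing function $\theta$ on $[0,\infty)$. *)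

theory Defs
  imports "HOL-Probability.Probability"
begin

text \<open>Entropy: Ent_mu(g) = int g ln g - int g ln(int g) if int g ln g < infinity, else infinity.
  For g \<ge> 0 on a probability space, g ln g \<ge> -1/e, so "int g ln g < infinity" means integrability.\<close>
definition Ent :: "real measure \<Rightarrow> (real \<Rightarrow> real) \<Rightarrow> ereal" where
  "Ent \<mu> g = (if integrable \<mu> (\<lambda>x. g x * ln (g x))
     then ereal ((\<integral>x. g x * ln (g x) \<partial>\<mu>) - (\<integral>x. g x \<partial>\<mu>) * ln (\<integral>x. g x \<partial>\<mu>))
     else \<infinity>)"

definition legendre :: "(real \<Rightarrow> real) \<Rightarrow> real \<Rightarrow> real" where
  "legendre H x = (SUP y. x * y - H y)"

text \<open>Distribution function and generalized inverse (used only at t in (0,1), where it is finite).\<close>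
definition distr_fun :: "real measure \<Rightarrow> real \<Rightarrow> real" where
  "distr_fun \<mu> x = measure \<mu> {..x}"

definition quantile :: "real measure \<Rightarrow> real \<Rightarrow> real" where
  "quantile \<mu> t = Inf {y. distr_fun \<mu> y \<ge> t}"

definition F_tau :: "real \<Rightarrow> real" where
  "F_tau x = (if x < 0 then exp x / 2 else 1 - exp (- x) / 2)"

definition U_map :: "real measure \<Rightarrow> real \<Rightarrow> real" where
  "U_map \<mu> x = quantile \<mu> (F_tau x)"

definition Delta :: "real measure \<Rightarrow> real \<Rightarrow> ereal" where
  "Delta \<mu> h = (SUP x. ereal (U_map \<mu> (x + h) - U_map \<mu> x))"

definition smooth :: "(real \<Rightarrow> real) \<Rightarrow> bool" where
  "smooth f \<longleftrightarrow> (\<forall>k x. ((deriv ^^ k) f) differentiable (at x))"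

end

theory Submission
  imports Defs "HOL-Real_Asymp.Real_Asymp"
begin

text \<open>
  Write \<open>\<theta> = H\<^sup>*\<close> and \<open>U\<close> for the monotone map transporting the symmetric exponential law onto \<open>\<mu>\<close>.

  From the log-Sobolev inequality to the condition on \<open>U\<close>: test the inequality on the hinges
  \<open>\<lambda> (x - u)\<^sub>+\<close> and their reflections, where \<open>p = \<mu> (u, \<infinity>) \<le> 1/2\<close>. For the logarithm \<open>V(\<lambda>)\<close> of the
  exponential moment conditioned on \<open>(u, \<infinity>)\<close>, a two-point lower bound on the entropy bounds \<open>V\<close>
  for small \<open>\<lambda>\<close> independently of \<open>u\<close>, and Jensen's inequality gives the discrete Herbst step
  \<open>V(\<lambda>) \<le> 2 V(\<lambda>/2) + H(c\<lambda>)\<close>. Iterated, the growth condition on \<open>H\<close> turns it into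
  \<open>V(\<lambda>) \<le> C + K\<lambda> + A' H(c\<lambda>)\<close>, and Chernoff's bound yields \<open>\<mu> (u + r, \<infinity>) \<le> 6 p exp (- \<theta>((r - K)/(cA')))\<close>,
  which is the condition on \<open>U\<close>.

  Conversely, with \<open>a\<close> the value of \<open>\<phi>\<close> at the median \<open>U 0\<close> and \<open>\<psi>(x) = x e\<^sup>x - e\<^sup>x + 1\<close>, the entropy of
  \<open>e\<^sup>\<phi>\<close> is at most the integral of \<open>e\<^sup>a \<psi>(\<phi> - a)\<close>. Where \<open>\<phi> \<le> a\<close>, convexity compares it with the slope at the
  median. Where \<open>\<phi> > a\<close>, the increments of \<open>F = (\<phi> \<circ> U - a)\<^sub>+\<close> over a step \<open>n\<close> are at most
  \<open>\<phi>'(U y) \<theta>\<^sup>-\<^sup>1(t\<^sub>0\<^sup>2 + n) / b\<close>. With \<open>n\<close> of order \<open>1 + H(c \<phi>'(U y))\<close>, Young's inequality bounds the increment by \<open>n/2\<close>, so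
  \<open>\<psi>(F y) \<le> C H(c \<phi>'(U y)) exp (F y) + exp (3n/4) \<psi>(F (y - n))\<close>; integrated against \<open>exp (- y)\<close>, the last terms
  form a small multiple of the left-hand side and are absorbed.
\<close>

section \<open>The cost function and its Legendre transform\<close>

locale young_cost =
  fixes H :: "real \<Rightarrow> real" and t0 A \<alpha> :: real
  assumes H_nonneg: "0 \<le> H x"
    and H_sym: "H (- x) = H x"
    and H_convex: "convex_on UNIV H"
    and t0_pos: "t0 > 0"
    and H_quad: "\<bar>x\<bar> \<le> 2 * t0 \<Longrightarrow> H x = x\<^sup>2 / 4"
    and A_ge: "A \<ge> 1"
    and alpha_gt: "1 < \<alpha>"
    and H_growth: "0 \<le> s \<Longrightarrow> s \<le> 1 \<Longrightarrow> H (s * x) \<le> A * s powr \<alpha> * H x"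
begin

abbreviation \<theta> :: "real \<Rightarrow> real" where "\<theta> \<equiv> legendre H"

abbreviation \<theta>_inv :: "real \<Rightarrow> real" where "\<theta>_inv \<equiv> the_inv_into {0..} \<theta>"

lemma H_0 [simp]: "H 0 = 0"
  using H_quad[of 0] t0_pos by simp

lemma H_continuous: "continuous_on UNIV H"
  by (rule convex_on_continuous[OF open_UNIV H_convex])

lemma H_measurable [measurable]: "H \<in> borel_measurable borel"
  by (rule borel_measurable_continuous_onI[OF H_continuous])

lemma H_abs [simp]: "H \<bar>x\<bar> = H x"
  using H_sym[of x] by (simp add: abs_if)

lemma H_contract:
  assumes "0 \<le> s" "s \<le> 1"
  shows "H (s * x) \<le> s * H x"
  using convex_onD[OF H_convex, of s 0 x] assms by simp

lemma H_scale:
  assumes "1 \<le> s"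
  shows "s * H x \<le> H (s * x)"
  using H_contract[of "1 / s" "s * x"] assms by (simp add: field_simps)

lemma H_mono:
  assumes "\<bar>x\<bar> \<le> \<bar>y\<bar>"
  shows "H x \<le> H y"
proof (cases "y = 0")
  case False
  have "H (\<bar>x\<bar> / \<bar>y\<bar> * \<bar>y\<bar>) \<le> \<bar>x\<bar> / \<bar>y\<bar> * H \<bar>y\<bar>"
    by (rule H_contract) (use assms False in \<open>auto simp: field_simps\<close>)
  also have "\<dots> \<le> 1 * H \<bar>y\<bar>"
    using assms False H_nonneg by (intro mult_right_mono) (auto simp: field_simps)
  finally show ?thesis using False by simp
qed (use assms in auto)

lemma H_ge_t0:
  assumes "2 * t0 \<le> \<bar>x\<bar>"
  shows "t0\<^sup>2 \<le> H x"
  using H_mono[of "2 * t0" x] H_quad[of "2 * t0"] assms t0_pos by (simp add: power2_eq_square)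

text \<open>The growth condition with s = 2 t0 / |y| bounds H y below by a multiple of |y|^\<alpha>,
  and \<alpha> > 1 beats any slope x. This keeps the real-valued supremum in \<open>legendre\<close>
  finite.\<close>

lemma H_dominates_linear: "\<exists>R\<ge>0. \<forall>y. R \<le> \<bar>y\<bar> \<longrightarrow> x * y \<le> H y"
proof -
  \<comment> \<open>Chosen so that |y|^(\<alpha> - 1) >= q turns the lower bound t0^2 |y|^\<alpha>
    <= A (2 t0)^\<alpha> H y into (|x| + 1) |y| <= H y.\<close>
  define q where "q = (2 * t0) powr \<alpha> * A * (\<bar>x\<bar> + 1) / t0\<^sup>2"
  have q: "q > 0"
    unfolding q_def using t0_pos A_ge by (intro divide_pos_pos mult_pos_pos) auto
  define R where "R = max (2 * t0) (q powr (1 / (\<alpha> - 1)))"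
  have "x * y \<le> H y" if y: "R \<le> \<bar>y\<bar>" for y
  proof -
    have y0: "2 * t0 \<le> \<bar>y\<bar>" "0 < \<bar>y\<bar>" using y t0_pos by (auto simp: R_def)
    have "q = (q powr (1 / (\<alpha> - 1))) powr (\<alpha> - 1)"
      using q alpha_gt by (simp add: powr_powr)
    also have "\<dots> \<le> \<bar>y\<bar> powr (\<alpha> - 1)"
      using y alpha_gt by (intro powr_mono2) (auto simp: R_def)
    finally have *: "q \<le> \<bar>y\<bar> powr (\<alpha> - 1)" .
    have "t0\<^sup>2 = H (2 * t0 / \<bar>y\<bar> * \<bar>y\<bar>)"
      using y0 H_quad[of "2 * t0"] t0_pos by (simp add: power2_eq_square)
    also have "\<dots> \<le> A * (2 * t0 / \<bar>y\<bar>) powr \<alpha> * H \<bar>y\<bar>"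
      using y0 t0_pos by (intro H_growth) (auto simp: field_simps)
    also have "\<dots> = A * (2 * t0) powr \<alpha> * H y / \<bar>y\<bar> powr \<alpha>"
      using y0 t0_pos by (simp add: powr_divide)
    finally have 1: "t0\<^sup>2 * \<bar>y\<bar> powr \<alpha> \<le> A * (2 * t0) powr \<alpha> * H y"
      using y0 by (simp add: field_simps)
    have "A * (2 * t0) powr \<alpha> * (\<bar>x\<bar> + 1) * \<bar>y\<bar> = t0\<^sup>2 * (q * \<bar>y\<bar>)"
      using t0_pos by (simp add: q_def)
    also have "\<dots> \<le> t0\<^sup>2 * (\<bar>y\<bar> powr (\<alpha> - 1) * \<bar>y\<bar>)"
      using * by (intro mult_left_mono mult_right_mono) auto
    also have "\<dots> = t0\<^sup>2 * \<bar>y\<bar> powr \<alpha>"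
      using y0 by (simp add: powr_mult_base mult.commute)
    finally have "A * (2 * t0) powr \<alpha> * ((\<bar>x\<bar> + 1) * \<bar>y\<bar>) \<le> A * (2 * t0) powr \<alpha> * H y"
      using 1 by (simp add: mult.assoc)
    then have "(\<bar>x\<bar> + 1) * \<bar>y\<bar> \<le> H y"
      using A_ge t0_pos by (subst (asm) mult_le_cancel_left_pos) auto
    moreover have "x * y \<le> (\<bar>x\<bar> + 1) * \<bar>y\<bar>"
      using abs_ge_self[of "x * y"] by (simp add: abs_mult algebra_simps)
    ultimately show ?thesis by simp
  qed
  moreover have "R \<ge> 0" using t0_pos by (simp add: R_def)
  ultimately show ?thesis by blast
qed

section \<open>Finiteness, convexity and inverse of the Legendre transform\<close>

lemma bdd_above_legendre: "bdd_above (range (\<lambda>y. x * y - H y))"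
proof -
  obtain R where R: "R \<ge> 0" "\<And>y. R \<le> \<bar>y\<bar> \<Longrightarrow> x * y \<le> H y"
    using H_dominates_linear by blast
  have "x * y - H y \<le> \<bar>x\<bar> * R" for y
  proof (cases "R \<le> \<bar>y\<bar>")
    case True
    then show ?thesis using R(2)[of y] R(1) by (smt (verit) mult_nonneg_nonneg)
  next
    case False
    then have "x * y \<le> \<bar>x\<bar> * R"
      using abs_ge_self[of "x * y"] mult_left_mono[of "\<bar>y\<bar>" R "\<bar>x\<bar>"] by (simp add: abs_mult)
    then show ?thesis using H_nonneg[of y] by simp
  qed
  then show ?thesis by (intro bdd_aboveI2)
qed

lemma young: "x * y \<le> H y + \<theta> x"
  using cSUP_upper[OF UNIV_I bdd_above_legendre, of x y] by (simp add: legendre_def)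

lemma legendre_leI: "(\<And>y. x * y - H y \<le> z) \<Longrightarrow> \<theta> x \<le> z"
  unfolding legendre_def by (rule cSUP_least) auto

lemma legendre_0 [simp]: "\<theta> 0 = 0"
  using young[of 0 0] legendre_leI[of 0 0] H_nonneg by (auto intro: antisym)

lemma legendre_pos:
  assumes "x > 0"
  shows "\<theta> x > 0"
proof -
  \<comment> \<open>In the quadratic range H y = y^2 / 4, while y <= x gives x y >= y^2; so this y
    makes the supremum positive.\<close>
  define y where "y = min (2 * t0) x"
  have y: "0 < y" "y \<le> 2 * t0" "y \<le> x" using assms t0_pos by (auto simp: y_def)
  have "y\<^sup>2 / 4 < x * y"
    using y mult_right_mono[of y x y] by (simp add: power2_eq_square)
  then show ?thesis using young[of x y] H_quad[of y] y by simp
qed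

lemma legendre_convex: "convex_on UNIV \<theta>"
proof (rule convex_onI)
  fix t x y :: real assume t: "0 < t" "t < 1"
  show "\<theta> ((1 - t) *\<^sub>R x + t *\<^sub>R y) \<le> (1 - t) * \<theta> x + t * \<theta> y"
  proof (rule legendre_leI)
    fix z
    have "((1 - t) *\<^sub>R x + t *\<^sub>R y) * z - H z = (1 - t) * (x * z - H z) + t * (y * z - H z)"
      by (simp add: algebra_simps)
    also have "\<dots> \<le> (1 - t) * \<theta> x + t * \<theta> y"
      using t young[of x z] young[of y z] by (intro add_mono mult_left_mono) auto
    finally show "((1 - t) *\<^sub>R x + t *\<^sub>R y) * z - H z \<le> (1 - t) * \<theta> x + t * \<theta> y" .
  qed
qed simp

lemma legendre_contract:
  assumes "0 \<le> s" "s \<le> 1"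
  shows "\<theta> (s * x) \<le> s * \<theta> x"
  using convex_onD[OF legendre_convex, of s 0 x] assms by simp

lemma legendre_scale:
  assumes "1 \<le> s"
  shows "s * \<theta> x \<le> \<theta> (s * x)"
  using legendre_contract[of "1 / s" "s * x"] assms by (simp add: field_simps)

lemma legendre_strict_mono:
  assumes "0 \<le> x" "x < y"
  shows "\<theta> x < \<theta> y"
proof -
  have "\<theta> (x / y * y) \<le> x / y * \<theta> y"
    by (rule legendre_contract) (use assms in auto)
  also have "\<dots> < 1 * \<theta> y"
    using assms legendre_pos[of y] by (intro mult_strict_right_mono) auto
  finally show ?thesis using assms by simp
qed

lemma legendre_le_iff: "0 \<le> x \<Longrightarrow> 0 \<le> y \<Longrightarrow> \<theta> x \<le> \<theta> y \<longleftrightarrow> x \<le> y"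
  by (metis legendre_strict_mono linorder_not_less order_le_less)

lemma legendre_inj: "inj_on \<theta> {0..}"
  by (rule inj_onI) (metis atLeast_iff legendre_le_iff order_antisym order_refl)

lemma legendre_surj:
  assumes "v \<ge> 0"
  shows "\<exists>r\<ge>0. \<theta> r = v"
proof -
  \<comment> \<open>Solves 2 t0 x - t0^2 = v, where the left side is the lower bound for \<theta> x
    given by Young's inequality at 2 t0.\<close>
  define x where "x = (v + t0\<^sup>2) / (2 * t0)"
  have x: "0 \<le> x" using assms t0_pos by (simp add: x_def)
  have "x * (2 * t0) \<le> H (2 * t0) + \<theta> x" by (rule young)
  then have "v \<le> \<theta> x"
    using H_quad[of "2 * t0"] t0_pos by (simp add: x_def power2_eq_square)
  moreover have "continuous_on {0..x} \<theta>"
    using convex_on_continuous[OF open_UNIV legendre_convex] continuous_on_subset by blast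
  ultimately show ?thesis
    using IVT'[of \<theta> 0 v x] assms x by auto
qed

lemma legendre_inv:
  assumes "v \<ge> 0"
  shows legendre_inv_eq: "\<theta> (\<theta>_inv v) = v" and legendre_inv_nonneg: "\<theta>_inv v \<ge> 0"
proof -
  obtain r where "r \<ge> 0" "\<theta> r = v" using legendre_surj[OF assms] by blast
  then have "v \<in> \<theta> ` {0..}" by auto
  then show "\<theta> (\<theta>_inv v) = v" "\<theta>_inv v \<ge> 0"
    using f_the_inv_into_f[OF legendre_inj] the_inv_into_into[OF legendre_inj _ order_refl]
    by (blast, fastforce)
qed

lemma legendre_inv_le:
  assumes "0 \<le> v" "0 \<le> r" "v \<le> \<theta> r"
  shows "\<theta>_inv v \<le> r"
  using legendre_inv[OF assms(1)] legendre_le_iff[of "\<theta>_inv v" r] assms by simp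

lemma legendre_inv_mono: "0 \<le> v \<Longrightarrow> v \<le> w \<Longrightarrow> \<theta>_inv v \<le> \<theta>_inv w"
  by (rule legendre_inv_le) (auto simp: legendre_inv)

lemma legendre_inv_pos: "v > 0 \<Longrightarrow> \<theta>_inv v > 0"
  using legendre_inv[of v] by (metis legendre_0 order_less_le)

text \<open>Convexity with \<theta> 0 = 0 makes the inverse subhomogeneous. This later absorbs
  additive constants in its argument.\<close>

lemma legendre_inv_scale:
  assumes "1 \<le> s" "0 \<le> v"
  shows "\<theta>_inv (s * v) \<le> s * \<theta>_inv v"
  using legendre_scale[OF assms(1), of "\<theta>_inv v"] legendre_inv[OF assms(2)] assms
  by (intro legendre_inv_le) auto

text \<open>Young's inequality with the factor e moved from one variable to the other. It trades
  increments of the transport map for a small multiple of the step plus a value of H.\<close>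

lemma mult_legendre_inv_le:
  assumes "0 < e" "e \<le> 1" "0 \<le> v"
  shows "k * \<theta>_inv v \<le> H (k / e) + e * v"
proof -
  have "k * \<theta>_inv v = (e * \<theta>_inv v) * (k / e)" using assms by simp
  also have "\<dots> \<le> H (k / e) + \<theta> (e * \<theta>_inv v)" by (rule young)
  also have "\<theta> (e * \<theta>_inv v) \<le> e * v"
    using legendre_contract[of e "\<theta>_inv v"] legendre_inv[OF assms(3)] assms by simp
  finally show ?thesis by simp
qed

end

section \<open>A Hardy-type inequality\<close>

text \<open>\<open>exp a * psi (x - a)\<close> is the Bregman divergence of t ln t between exp x and
  exp a.\<close>

definition psi :: "real \<Rightarrow> real" where
  "psi x = x * exp x - exp x + 1"

lemma psi_0 [simp]: "psi 0 = 0"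
  by (simp add: psi_def)

lemma psi_measurable [measurable]: "psi \<in> borel_measurable borel"
  unfolding psi_def by measurable

lemma has_real_derivative_psi: "(psi has_real_derivative x * exp x) (at x)"
  unfolding psi_def [abs_def] by (auto intro!: derivative_eq_intros simp: algebra_simps)

lemma psi_mono:
  assumes "0 \<le> x" "x \<le> y"
  shows "psi x \<le> psi y"
  by (rule DERIV_nonneg_imp_nondecreasing[OF assms(2)])
     (use has_real_derivative_psi assms in \<open>force intro!: mult_nonneg_nonneg\<close>)

lemma psi_nonneg: "0 \<le> psi x"
proof -
  have "1 + - x \<le> exp (- x)" by (rule exp_ge_add_one_self)
  then have "(1 - x) * exp x \<le> exp (- x) * exp x" by (intro mult_right_mono) auto
  then show ?thesis by (simp add: psi_def algebra_simps flip: exp_add)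
qed

lemma psi_ge_square:
  assumes "0 \<le> x"
  shows "x\<^sup>2 / 2 \<le> psi x"
proof -
  have "psi 0 - 0\<^sup>2 / 2 \<le> psi x - x\<^sup>2 / 2"
  proof (rule DERIV_nonneg_imp_nondecreasing[OF assms])
    fix y :: real assume "0 \<le> y"
    then have "0 \<le> y * exp y - y"
      using mult_left_mono[of 1 "exp y" y] by simp
    then show "\<exists>d. ((\<lambda>x. psi x - x\<^sup>2 / 2) has_real_derivative d) (at y) \<and> 0 \<le> d"
      by (intro exI[of _ "y * exp y - y"])
         (auto intro!: derivative_eq_intros has_real_derivative_psi)
  qed
  then show ?thesis by simp
qed

lemma psi_ge_mult_exp:
  assumes "1 \<le> x"
  shows "x * exp x / 4 \<le> psi x"
\<comment> \<open>From 4/3 on, x / 4 <= x - 1. Below, the claim reads (1 - 3x/4) exp x <= 1; the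
  first factor is at most 1/4 and exp (4/3) <= 4.\<close>
proof (cases "4 / 3 \<le> x")
  case True
  then have "x / 4 * exp x \<le> (x - 1) * exp x" by (intro mult_right_mono) auto
  then show ?thesis by (simp add: psi_def algebra_simps)
next
  case False
  have "exp (4 / 3 :: real) ^ 3 = exp 1 ^ 4"
    by (simp flip: exp_of_nat_mult)
  also have "\<dots> \<le> (2.8 :: real) ^ 4"
    using e_less_272 by (intro power_mono) auto
  also have "\<dots> \<le> 4 ^ 3" by (simp add: power_divide)
  finally have e: "exp (4 / 3 :: real) \<le> 4"
    by (rule power_le_imp_le_base[of _ 2, simplified numeral_3_eq_3[symmetric] numeral_2_eq_2]) simp
  have "(1 - 3 / 4 * x) * exp x \<le> 1 / 4 * 4"
    using False assms e by (intro mult_mono) (auto intro: order_trans[OF _ e])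
  then show ?thesis by (simp add: psi_def algebra_simps)
qed

lemma psi_le_mult_exp: "0 \<le> x \<Longrightarrow> psi x \<le> x * exp x"
  by (simp add: psi_def)

lemma psi_le_square_exp:
  assumes "0 \<le> x"
  shows "psi x \<le> x\<^sup>2 * exp x"
proof -
  \<comment> \<open>The product is 1 + x^3.\<close>
  have "1 \<le> (x\<^sup>2 - x + 1) * (1 + x)"
    using assms by (simp add: algebra_simps power2_eq_square)
  also have "\<dots> \<le> (x\<^sup>2 - x + 1) * exp x"
    using zero_le_power2[of "x - 1/2"]
    by (intro mult_left_mono) (auto simp: power2_eq_square algebra_simps)
  finally show ?thesis by (simp add: psi_def algebra_simps)
qed

lemma psi_neg_le_one: "0 \<le> d \<Longrightarrow> psi (- d) \<le> 1"
  using mult_nonneg_nonneg[of "1 + d" "exp (- d)"] by (simp add: psi_def algebra_simps)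

lemma psi_neg_le_square:
  assumes "0 \<le> d"
  shows "psi (- d) \<le> d\<^sup>2"
proof -
  have "(1 + d) * (1 + - d) \<le> (1 + d) * exp (- d)"
    using assms by (intro mult_left_mono exp_ge_add_one_self) auto
  then show ?thesis by (simp add: psi_def algebra_simps power2_eq_square)
qed

text \<open>The factor exp (3n/4) is to stay below exp n, the decay of exp (-y) over a step n. For x
  < 1 the bound d <= x leaves a doubling of x in the quadratic regime. For x >= 1 the increment n/2
  costs exp (n/2) and a factor linear in n, which exp (n/4) absorbs.\<close>

lemma psi_add_le:
  assumes "0 \<le> d" "d \<le> x" "d \<le> n / 2" "60 \<le> exp (3 * n / 4)" "4 * (1 + n / 2) \<le> exp (n / 4)"
  shows "psi (x + d) \<le> exp (3 * n / 4) * psi x"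
proof (cases "1 \<le> x")
  case False
  \<comment> \<open>With e < 2.72 the doubling constant is 8 * 2.72^2 = 59.1872, just below
    60.\<close>
  have e: "exp (2 :: real) \<le> 2.72 ^ 2"
    using e_less_272 power_mono[of "exp 1" "2.72 :: real" 2] by (simp flip: exp_of_nat_mult)
  have "psi (x + d) \<le> psi (2 * x)" by (rule psi_mono) (use assms in auto)
  also have "\<dots> \<le> (2 * x)\<^sup>2 * exp (2 * x)" by (rule psi_le_square_exp) (use assms in auto)
  also have "\<dots> \<le> (2 * x)\<^sup>2 * 2.72 ^ 2"
    using False by (intro mult_left_mono order_trans[OF _ e]) auto
  also have "\<dots> = 59.1872 * (x\<^sup>2 / 2)" by (simp add: power2_eq_square)
  also have "\<dots> \<le> exp (3 * n / 4) * psi x"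
    using assms psi_ge_square[of x] by (intro mult_mono) auto
  finally show ?thesis .
next
  case True
  have n: "0 \<le> n" using assms by simp
  have "psi (x + d) \<le> psi (x + n / 2)" by (rule psi_mono) (use assms in auto)
  also have "\<dots> \<le> (x + n / 2) * exp (x + n / 2)"
    by (rule psi_le_mult_exp) (use assms in auto)
  also have "\<dots> \<le> (x * (1 + n / 2)) * exp (x + n / 2)"
    using True n mult_right_mono[of 1 x "n / 2"] by (intro mult_right_mono) (auto simp: algebra_simps)
  also have "\<dots> = (4 * (1 + n / 2)) * exp (n / 2) * (x * exp x / 4)"
    by (simp add: exp_add)
  also have "\<dots> \<le> exp (n / 4) * exp (n / 2) * psi x"
    using assms psi_ge_mult_exp[OF True] True n by (intro mult_mono) auto
  also have "exp (n / 4) * exp (n / 2) = exp (3 * n / 4)"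
    by (simp flip: exp_add)
  finally show ?thesis .
qed

section \<open>Comparison across a step and absorption\<close>

context young_cost
begin

text \<open>The step n is of order 1 + H (8k/b), which keeps the increment d below n/2. If d <= u,
  \<open>psi_add_le\<close> applies. Otherwise v <= 2d and the H-term alone suffices, through psi v
  <= v^2 exp v for small k and psi v <= v exp v for large k. The step depends on k but not on u and
  v; C is uniform in all three.\<close>

lemma psi_increment:
  assumes b: "b > 0" and n0: "t0\<^sup>2 \<le> real n0"
    "\<And>n. n0 \<le> n \<Longrightarrow> 60 \<le> exp (3 * real n / 4)"
    "\<And>n. n0 \<le> n \<Longrightarrow> 4 * (1 + real n / 2) \<le> exp (real n / 4)"
  shows "\<exists>C>0. \<forall>k\<ge>0. \<exists>n\<ge>n0. \<forall>u\<ge>0. \<forall>v\<ge>0. v \<le> u + k * \<theta>_inv (t0\<^sup>2 + real n) / b \<longrightarrow>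
           psi v \<le> C * H (8 / b * k) * exp v + exp (3 * real n / 4) * psi u"
proof -
  \<comment> \<open>An upper bound for n as long as 8k/b <= 2 t0, where h <= t0^2; there d <= k
    D.\<close>
  define n1 where "n1 = real n0 + 16 * t0\<^sup>2 + 1"
  define D where "D = \<theta>_inv (t0\<^sup>2 + n1) / b"
  \<comment> \<open>First entry: v <= 2kD in the quadratic range, where h = 16 k^2 / b^2. Second
    entry: beyond it h >= t0^2, so the constant in v <= n <= n0 + 16h + 1 is absorbed in h.\<close>
  define C where "C = max (b\<^sup>2 * D\<^sup>2 / 4) ((real n0 + 1) / t0\<^sup>2 + 16)"
  have C: "C > 0" using t0_pos by (auto simp: C_def less_max_iff_disj intro!: add_nonneg_pos)
  have "\<exists>n\<ge>n0. \<forall>u\<ge>0. \<forall>v\<ge>0. v \<le> u + k * \<theta>_inv (t0\<^sup>2 + real n) / b \<longrightarrow>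
           psi v \<le> C * H (8 / b * k) * exp v + exp (3 * real n / 4) * psi u" if k: "k \<ge> 0" for k
  proof -
    define h where "h = H (8 / b * k)"
    have h: "h \<ge> 0" by (simp add: h_def H_nonneg)
    define n where "n = nat \<lceil>real n0 + 16 * h\<rceil>"
    have "real n0 + 16 * h \<ge> 0" using h by simp
    then have n: "real n0 + 16 * h \<le> real n" "real n \<le> real n0 + 16 * h + 1"
      unfolding n_def by linarith+
    have n_ge: "n0 \<le> n" using n h by simp
    define d where "d = k * \<theta>_inv (t0\<^sup>2 + real n) / b"
    have d0: "d \<ge> 0" using k b by (auto simp: d_def intro!: mult_nonneg_nonneg legendre_inv_nonneg divide_nonneg_pos)
    have "d = k / b * \<theta>_inv (t0\<^sup>2 + real n)" by (simp add: d_def)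
    \<comment> \<open>With h <= n/16 and t0^2 <= n, the choice e = 1/8 yields d <= 5n/16, within the
      required n/2.\<close>
    also have "\<dots> \<le> H (k / b / (1/8)) + 1/8 * (t0\<^sup>2 + real n)" by (rule mult_legendre_inv_le) auto
    also have "H (k / b / (1/8)) = h" by (simp add: h_def mult.commute)
    finally have "d \<le> h + t0\<^sup>2 / 8 + real n / 8" by (simp add: add_divide_distrib)
    then have d_le: "d \<le> real n / 2" using n n0(1) h zero_le_power2[of t0] by linarith
    have "psi v \<le> C * h * exp v + exp (3 * real n / 4) * psi u"
      if uv: "u \<ge> 0" "v \<ge> 0" "v \<le> u + d" for u v
    proof (cases "d \<le> u")
      case True
      have "psi v \<le> psi (u + d)" using uv by (intro psi_mono)
      also have "\<dots> \<le> exp (3 * real n / 4) * psi u"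
        using d0 True d_le n0(2,3)[OF n_ge] by (rule psi_add_le)
      also have "\<dots> \<le> C * h * exp v + exp (3 * real n / 4) * psi u" using C h by simp
      finally show ?thesis .
    next
      case False
      have v: "v \<le> 2 * d" using False uv by simp
      have "psi v \<le> C * h * exp v"
      proof (cases "8 / b * k \<le> 2 * t0")
        case True
        then have h_eq: "h = (8 / b * k)\<^sup>2 / 4" using k b by (simp add: h_def H_quad)
        have "h \<le> (2 * t0)\<^sup>2 / 4" unfolding h_eq using True k b
          by (intro divide_right_mono power_mono) auto
        then have "real n \<le> n1" using n by (simp add: n1_def)
        then have "d \<le> k * D" unfolding d_def D_def
          using k b by (auto intro!: mult_left_mono divide_right_mono legendre_inv_mono)
        then have "v \<le> 2 * (k * D)" using v by simp
        then have "v\<^sup>2 \<le> (2 * (k * D))\<^sup>2" using uv by (intro power_mono)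
        also have "\<dots> = b\<^sup>2 * D\<^sup>2 / 4 * h"
          unfolding h_eq using b by (simp add: power2_eq_square)
        also have "\<dots> \<le> C * h" using h by (intro mult_right_mono) (auto simp: C_def)
        finally have "v\<^sup>2 * exp v \<le> C * h * exp v" by (intro mult_right_mono) auto
        then show ?thesis using psi_le_square_exp[OF uv(2)] by linarith
      next
        case False
        then have "t0\<^sup>2 \<le> h" unfolding h_def by (intro H_ge_t0) linarith
        then have "(real n0 + 1) / t0\<^sup>2 * t0\<^sup>2 \<le> (real n0 + 1) / t0\<^sup>2 * h"
          by (intro mult_left_mono) auto
        then have "real n0 + 1 \<le> (real n0 + 1) / t0\<^sup>2 * h" using t0_pos by simp
        then have "v \<le> ((real n0 + 1) / t0\<^sup>2 + 16) * h"
          using v d_le n by (simp add: algebra_simps)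
        also have "\<dots> \<le> C * h" using h by (intro mult_right_mono) (auto simp: C_def)
        finally have "v * exp v \<le> C * h * exp v" by (intro mult_right_mono) auto
        then show ?thesis using psi_le_mult_exp[OF uv(2)] by linarith
      qed
      then show ?thesis using psi_nonneg[of u] by (smt (verit) exp_ge_zero mult_nonneg_nonneg)
    qed
    then show ?thesis using n_ge by (auto simp: d_def h_def)
  qed
  then show ?thesis using C by blast
qed

text \<open>The step n from \<open>psi_increment\<close> varies with y through k y; summing over all
  n >= n0 replaces it by shifts uniform in y. Against exp (-y) the shift by n contributes exp (-n/4)
  times the left-hand integral, and these weights add up to less than 1/2. Finiteness of that
  integral permits subtracting its half.\<close>

lemma hardy_inequality:
  assumes b: "b > 0"
  shows "\<exists>C>0. \<forall>F k. F \<in> borel_measurable borel \<longrightarrow> k \<in> borel_measurable borel \<longrightarrow>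
       (\<forall>y. 0 \<le> F y) \<longrightarrow> (\<forall>y. 0 \<le> k y) \<longrightarrow> F 0 = 0 \<longrightarrow>
       (\<forall>z\<ge>0. \<forall>y>z. F y \<le> F z + k y * \<theta>_inv (t0\<^sup>2 + (y - z)) / b) \<longrightarrow>
       (\<integral>\<^sup>+y. ennreal (psi (F y) * exp (- y)) * indicator {0..} y \<partial>lborel) < \<infinity> \<longrightarrow>
       (\<integral>\<^sup>+y. ennreal (psi (F y) * exp (- y)) * indicator {0..} y \<partial>lborel) \<le>
       ennreal C * (\<integral>\<^sup>+y. ennreal (H (8 / b * k y) * exp (F y) * exp (- y)) * indicator {0..} y \<partial>lborel)"
proof -
  have summ: "summable (\<lambda>m. exp (- real m / 4))"
  proof -
    have "(\<lambda>m. exp (- real m / 4)) = (\<lambda>m. exp (- 1 / 4) ^ m)"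
      by (auto simp flip: exp_of_nat_mult)
    then show ?thesis by (simp add: summable_geometric)
  qed
  have "eventually (\<lambda>n. t0\<^sup>2 \<le> real n) sequentially" by real_asymp
  moreover have "eventually (\<lambda>n. 60 \<le> exp (3 * real n / 4)) sequentially" by real_asymp
  moreover have "eventually (\<lambda>n. 4 * (1 + real n / 2) \<le> exp (real n / 4)) sequentially" by real_asymp
  moreover have "eventually (\<lambda>n. (\<Sum>m. exp (- real (m + n) / 4)) < 1 / 2) sequentially"
    using order_tendstoD(2)[OF suminf_exist_split2[OF summ], of "1/2"] by simp
  ultimately have "eventually (\<lambda>n. t0\<^sup>2 \<le> real n \<and> 60 \<le> exp (3 * real n / 4) \<and>
      4 * (1 + real n / 2) \<le> exp (real n / 4) \<and> (\<Sum>m. exp (- real (m + n) / 4)) < 1 / 2) sequentially"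
    by eventually_elim auto
  then obtain n0 where n0: "\<And>n. n \<ge> n0 \<Longrightarrow> t0\<^sup>2 \<le> real n" "\<And>n. n \<ge> n0 \<Longrightarrow> 60 \<le> exp (3 * real n / 4)"
      "\<And>n. n \<ge> n0 \<Longrightarrow> 4 * (1 + real n / 2) \<le> exp (real n / 4)"
      "(\<Sum>m. exp (- real (m + n0) / 4)) < 1 / 2"
    unfolding eventually_sequentially by blast
  obtain C where C: "C > 0" and incr: "\<And>k. k \<ge> 0 \<Longrightarrow> \<exists>n\<ge>n0. \<forall>u\<ge>0. \<forall>v\<ge>0.
      v \<le> u + k * \<theta>_inv (t0\<^sup>2 + real n) / b \<longrightarrow>
      psi v \<le> C * H (8 / b * k) * exp v + exp (3 * real n / 4) * psi u"
    using psi_increment[OF b n0(1)[OF order_refl] n0(2,3)] by blast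
  have "(\<integral>\<^sup>+y. ennreal (psi (F y) * exp (- y)) * indicator {0..} y \<partial>lborel) \<le>
      ennreal (2 * C) * (\<integral>\<^sup>+y. ennreal (H (8 / b * k y) * exp (F y) * exp (- y)) * indicator {0..} y \<partial>lborel)"
    if F[measurable]: "F \<in> borel_measurable borel" and k[measurable]: "k \<in> borel_measurable borel"
      and F0: "\<And>y. 0 \<le> F y" and k0: "\<And>y. 0 \<le> k y" and F00: "F 0 = 0"
      and step: "\<And>z y. z \<ge> 0 \<Longrightarrow> y > z \<Longrightarrow> F y \<le> F z + k y * \<theta>_inv (t0\<^sup>2 + (y - z)) / b"
      and fin: "(\<integral>\<^sup>+y. ennreal (psi (F y) * exp (- y)) * indicator {0..} y \<partial>lborel) < \<infinity>"
    for F k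
  proof -
    define I where "I = (\<integral>\<^sup>+y. ennreal (psi (F y) * exp (- y)) * indicator {0..} y \<partial>lborel)"
    define J where "J = (\<integral>\<^sup>+y. ennreal (H (8 / b * k y) * exp (F y) * exp (- y)) * indicator {0..} y \<partial>lborel)"
    \<comment> \<open>With n = m + n0 this is the shifted term, since exp (3n/4) exp (-y) = exp
      (-n/4) exp (-(y - n)).\<close>
    define g where "g m y = ennreal (exp (- real (m + n0) / 4)) *
        (ennreal (psi (F (y - real (m + n0))) * exp (- (y - real (m + n0)))) * indicator {0..} (y - real (m + n0)))"
      for m y
    have g_meas[measurable]: "g m \<in> borel_measurable borel" for m
      unfolding g_def by measurable
    have pw: "ennreal (psi (F y) * exp (- y)) * indicator {0..} y \<le>
        ennreal C * (ennreal (H (8 / b * k y) * exp (F y) * exp (- y)) * indicator {0..} y) + (\<Sum>m. g m y)"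
      (is "?l \<le> ?r + _") for y
    proof (cases "y > 0")
      case False
      then show ?thesis using F00 by (cases "y = 0") (auto simp: indicator_def)
    next
      case True
      obtain n where n: "n0 \<le> n" and *: "\<And>u. u \<ge> 0 \<Longrightarrow> F y \<le> u + k y * \<theta>_inv (t0\<^sup>2 + real n) / b \<Longrightarrow>
          psi (F y) \<le> C * H (8 / b * k y) * exp (F y) + exp (3 * real n / 4) * psi u"
        using incr[OF k0[of y]] F0[of y] by blast
      show ?thesis
      proof (cases "y < real n")
        case True
        \<comment> \<open>The step would pass the origin, so the comparison point is 0, where F
          vanishes; \<open>psi 0 = 0\<close> removes the shifted term.\<close>
        have "F y \<le> 0 + k y * \<theta>_inv (t0\<^sup>2 + (y - 0)) / b"
          using step[of 0 y] \<open>y > 0\<close> F00 by simp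
        also have "\<dots> \<le> 0 + k y * \<theta>_inv (t0\<^sup>2 + real n) / b"
          using True \<open>y > 0\<close> k0[of y] b
          by (auto intro!: divide_right_mono mult_left_mono legendre_inv_mono)
        finally have "psi (F y) \<le> C * H (8 / b * k y) * exp (F y)" using *[of 0] by simp
        then have "psi (F y) * exp (- y) \<le> C * (H (8 / b * k y) * exp (F y) * exp (- y))"
          by (simp add: mult.assoc[symmetric])
        then have "?l \<le> ?r" using C
          by (auto simp: indicator_def ennreal_mult[symmetric] H_nonneg intro!: ennreal_leI)
        then show ?thesis by (metis add_increasing2 zero_le)
      next
        case False
        then have yn: "y - real n \<ge> 0" by simp
        \<comment> \<open>\<open>step\<close> requires a positive distance; n = 0 contradicts 60 <=
          exp (3n/4).\<close>
        show ?thesis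
        proof (cases "n = 0")
          case True
          then show ?thesis using n0(2)[OF n] by simp
        next
          case False
          have "F y \<le> F (y - real n) + k y * \<theta>_inv (t0\<^sup>2 + (y - (y - real n))) / b"
            by (rule step) (use yn False in auto)
          then have "psi (F y) \<le> C * H (8 / b * k y) * exp (F y) + exp (3 * real n / 4) * psi (F (y - real n))"
            using *[OF F0] by simp
          then have "psi (F y) * exp (- y) \<le>
             (C * H (8 / b * k y) * exp (F y) + exp (3 * real n / 4) * psi (F (y - real n))) * exp (- y)"
            by (intro mult_right_mono) auto
          also have "\<dots> = C * (H (8 / b * k y) * exp (F y) * exp (- y)) +
             exp (- real n / 4) * (psi (F (y - real n)) * exp (- (y - real n)))"
            by (simp add: algebra_simps flip: exp_add)
          finally have "ennreal (psi (F y) * exp (- y)) \<le> ennreal \<dots>" by (rule ennreal_leI)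
          also have "\<dots> = ?r + ennreal (exp (- real n / 4)) * (ennreal (psi (F (y - real n)) * exp (- (y - real n))))"
            using C \<open>y > 0\<close> by (subst ennreal_plus)
              (auto simp: H_nonneg psi_nonneg ennreal_mult[symmetric] indicator_def)
          also have "\<dots> = ?r + g (n - n0) y" using n yn by (simp add: g_def indicator_def of_nat_diff)
          also have "\<dots> \<le> ?r + (\<Sum>m. g m y)"
            using sum_le_suminf[of "\<lambda>m. g m y" "{n - n0}"] by (intro add_left_mono) auto
          finally show ?thesis using \<open>y > 0\<close> by (simp add: indicator_def)
        qed
      qed
    qed
    have g_int: "(\<integral>\<^sup>+y. g m y \<partial>lborel) = ennreal (exp (- real (m + n0) / 4)) * I" for m
    proof -
      have "(\<integral>\<^sup>+y. g m y \<partial>lborel) = (\<integral>\<^sup>+y. g m (real (m + n0) + 1 * y) \<partial>lborel)"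
        using nn_integral_real_affine[OF g_meas, of 1 m "real (m + n0)"] by simp
      also have "\<dots> = ennreal (exp (- real (m + n0) / 4)) * I"
        unfolding g_def I_def by (simp add: nn_integral_cmult)
      finally show ?thesis .
    qed
    have "I \<le> (\<integral>\<^sup>+y. ennreal C * (ennreal (H (8 / b * k y) * exp (F y) * exp (- y)) * indicator {0..} y)
          + (\<Sum>m. g m y) \<partial>lborel)"
      unfolding I_def by (intro nn_integral_mono pw)
    also have "\<dots> = ennreal C * J + (\<Sum>m. ennreal (exp (- real (m + n0) / 4)) * I)"
      by (simp add: nn_integral_add nn_integral_cmult nn_integral_suminf J_def g_int)
    also have "(\<Sum>m. ennreal (exp (- real (m + n0) / 4)) * I) = (\<Sum>m. ennreal (exp (- real (m + n0) / 4))) * I"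
      by (rule ennreal_suminf_multc)
    also have "(\<Sum>m. ennreal (exp (- real (m + n0) / 4))) = ennreal (\<Sum>m. exp (- real (m + n0) / 4))"
      using summ by (intro suminf_ennreal2) (simp_all only: summable_iff_shift[of "\<lambda>m. exp (- real m / 4)"] exp_ge_zero)
    also have "\<dots> * I \<le> ennreal (1 / 2) * I"
      using n0(4) by (intro mult_right_mono ennreal_leI) auto
    finally have *: "I \<le> ennreal C * J + ennreal (1 / 2) * I" by (simp add: add_left_mono)
    have "I < \<infinity>" using fin by (simp add: I_def)
    then obtain i where i: "I = ennreal i" "i \<ge> 0" by (cases I) auto
    have "I \<le> ennreal (2 * C) * J"
    proof (cases J)
      case (real j)
      have "ennreal (C * j + 1 / 2 * i) = ennreal (C * j) + ennreal (1 / 2 * i)"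
        using C real i by (intro ennreal_plus) auto
      also have "ennreal (C * j) = ennreal C * J" using C real by (simp add: ennreal_mult)
      also have "ennreal (1 / 2 * i) = ennreal (1 / 2) * I" using i by (simp only: ennreal_mult)
      finally have "ennreal i \<le> ennreal (C * j + 1 / 2 * i)" using * i by simp
      then have "i \<le> C * j + 1 / 2 * i"
        using C real i by (subst (asm) ennreal_le_iff) auto
      then show ?thesis using C real i by (simp add: ennreal_mult[symmetric] ennreal_leI)
    next
      case top
      then show ?thesis using C by (simp add: ennreal_mult_top)
    qed
    then show ?thesis by (simp add: I_def J_def)
  qed
  then show ?thesis using C by (intro exI[of _ "2 * C"]) auto
qed

end

section \<open>The transport map\<close>

lemma F_tau_range: "0 < F_tau x" "F_tau x < 1"
  by (auto simp: F_tau_def field_simps) (smt (verit) exp_less_one_iff exp_le_one_iff)+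

lemma F_tau_strict_mono:
  assumes "x < y"
  shows "F_tau x < F_tau y"
proof -
  have "exp x + exp (- y) < 1 + 1" if "x < 0" "\<not> y < 0"
    using that by (intro add_less_le_mono) auto
  then show ?thesis using assms by (auto simp: F_tau_def field_simps)
qed

lemma F_tau_le_iff: "F_tau x \<le> F_tau y \<longleftrightarrow> x \<le> y"
  by (metis F_tau_strict_mono linorder_not_less order_le_less)

lemma F_tau_surj:
  assumes "0 < q" "q < 1"
  shows "\<exists>x. F_tau x = q"
proof (cases "q < 1 / 2")
  case True
  then have "ln (2 * q) < 0" using assms by (simp add: ln_less_zero)
  then show ?thesis using assms by (intro exI[of _ "ln (2 * q)"]) (simp add: F_tau_def)
next
  case False
  then have "ln (2 * (1 - q)) \<le> 0" using assms by simp
  then show ?thesis using assms by (intro exI[of _ "- ln (2 * (1 - q))"]) (simp add: F_tau_def field_simps)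
qed

text \<open>The negative half is reflected, because \<open>hardy_inequality\<close> lives on the
  half-line from 0. The two copies overlap only in the null point 0.\<close>

lemma nn_integral_laplace:
  fixes g :: "real \<Rightarrow> ennreal"
  assumes [measurable]: "g \<in> borel_measurable borel"
  shows "(\<integral>\<^sup>+x. g x * ennreal (exp (- \<bar>x\<bar>) / 2) \<partial>lborel) =
         (\<integral>\<^sup>+y. (g y + g (- y)) * ennreal (exp (- y) / 2) * indicator {0..} y \<partial>lborel)"
proof -
  have "(\<integral>\<^sup>+x. g x * ennreal (exp (- \<bar>x\<bar>) / 2) \<partial>lborel) =
    (\<integral>\<^sup>+x. g x * ennreal (exp (- \<bar>x\<bar>) / 2) * indicator {0..} x +
           g x * ennreal (exp (- \<bar>x\<bar>) / 2) * indicator {..<0} x \<partial>lborel)"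
    by (intro nn_integral_cong) (auto simp: indicator_def)
  also have "\<dots> = (\<integral>\<^sup>+x. g x * ennreal (exp (- \<bar>x\<bar>) / 2) * indicator {0..} x \<partial>lborel) +
      (\<integral>\<^sup>+x. g x * ennreal (exp (- \<bar>x\<bar>) / 2) * indicator {..<0} x \<partial>lborel)"
    by (rule nn_integral_add) measurable
  also have "(\<integral>\<^sup>+x. g x * ennreal (exp (- \<bar>x\<bar>) / 2) * indicator {..<0} x \<partial>lborel) =
      (\<integral>\<^sup>+x. g (- x) * ennreal (exp (- \<bar>x\<bar>) / 2) * indicator {..<0} (- x) \<partial>lborel)"
    by (subst nn_integral_real_affine[where c = "-1" and t = 0]) auto
  also have "\<dots> = (\<integral>\<^sup>+x. g (- x) * ennreal (exp (- \<bar>x\<bar>) / 2) * indicator {0..} x \<partial>lborel)"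
  proof (rule nn_integral_cong_AE)
    show "AE x in lborel. g (- x) * ennreal (exp (- \<bar>x\<bar>) / 2) * indicator {..<0} (- x) =
        g (- x) * ennreal (exp (- \<bar>x\<bar>) / 2) * indicator {0..} x"
      using AE_lborel_singleton[of 0] by eventually_elim (auto simp: indicator_def)
  qed
  also have "(\<integral>\<^sup>+x. g x * ennreal (exp (- \<bar>x\<bar>) / 2) * indicator {0..} x \<partial>lborel) + \<dots> =
    (\<integral>\<^sup>+x. g x * ennreal (exp (- \<bar>x\<bar>) / 2) * indicator {0..} x +
       g (- x) * ennreal (exp (- \<bar>x\<bar>) / 2) * indicator {0..} x \<partial>lborel)"
    by (rule nn_integral_add[symmetric]) measurable
  also have "\<dots> = (\<integral>\<^sup>+y. (g y + g (- y)) * ennreal (exp (- y) / 2) * indicator {0..} y \<partial>lborel)"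
    by (intro nn_integral_cong) (auto simp: indicator_def distrib_right)
  finally show ?thesis .
qed

lemma nn_integral_exp_atLeast:
  assumes "r > 0"
  shows "(\<integral>\<^sup>+y. ennreal (exp (- (r * y))) * indicator {a..} y \<partial>lborel) = ennreal (exp (- (r * a)) / r)"
proof -
  have "((\<lambda>y. - exp (- (r * y)) / r) \<longlongrightarrow> - 0 / r) at_top"
    using assms by (intro tendsto_intros filterlim_compose[OF exp_at_bot]
        filterlim_uminus_at_bot[THEN iffD1] filterlim_uminus_at_top[THEN iffD1]
        filterlim_tendsto_pos_mult_at_top[OF tendsto_const])
      (auto simp: filterlim_uminus_at_bot intro!: filterlim_tendsto_pos_mult_at_top[OF tendsto_const] filterlim_ident)
  then have "(\<integral>\<^sup>+y. ennreal (exp (- (r * y))) * indicator {a..} y \<partial>lborel) =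
      ennreal (- 0 / r - - exp (- (r * a)) / r)"
    using assms by (intro nn_integral_FTC_atLeast) (auto intro!: derivative_eq_intros)
  then show ?thesis by simp
qed

definition laplace :: "real measure" where
  "laplace = density lborel (\<lambda>x. ennreal (exp (- \<bar>x\<bar>) / 2))"

lemma sets_laplace [simp, measurable_cong]: "sets laplace = sets borel"
  by (simp add: laplace_def)

lemma space_laplace [simp]: "space laplace = UNIV"
  by (simp add: laplace_def)

lemma nn_integral_half_exp: "(\<integral>\<^sup>+y. ennreal (exp (- y) / 2) * indicator {a..} y \<partial>lborel) = ennreal (exp (- a) / 2)"
proof -
  have "(\<integral>\<^sup>+y. ennreal (exp (- y) / 2) * indicator {a..} y \<partial>lborel) =
     (\<integral>\<^sup>+y. ennreal (1 / 2) * (ennreal (exp (- (1 * y))) * indicator {a..} y) \<partial>lborel)"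
    by (intro nn_integral_cong) (auto simp: indicator_def ennreal_mult[symmetric] simp del: ennreal_half)
  also have "\<dots> = ennreal (1 / 2) * ennreal (exp (- (1 * a)) / 1)"
    by (subst nn_integral_cmult, measurable, subst nn_integral_exp_atLeast) auto
  also have "\<dots> = ennreal (exp (- a) / 2)"
    by (subst ennreal_mult[symmetric]) auto
  finally show ?thesis .
qed

lemma emeasure_laplace:
  assumes [measurable]: "S \<in> sets borel"
  shows "emeasure laplace S =
    (\<integral>\<^sup>+y. (indicator S y + indicator S (- y)) * ennreal (exp (- y) / 2) * indicator {0..} y \<partial>lborel)"
proof -
  have "emeasure laplace S = (\<integral>\<^sup>+x. indicator S x * ennreal (exp (- \<bar>x\<bar>) / 2) \<partial>lborel)"
    unfolding laplace_def by (simp add: emeasure_density mult.commute)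
  then show ?thesis by (simp add: nn_integral_laplace)
qed

lemma prob_space_laplace: "prob_space laplace"
proof
  have "emeasure laplace (space laplace) =
     (\<integral>\<^sup>+y. 2 * (ennreal (exp (- y) / 2) * indicator {0..} y) \<partial>lborel)"
    by (simp add: emeasure_laplace mult.assoc)
  also have "\<dots> = 2 * ennreal (1 / 2)"
    by (subst nn_integral_cmult) (use nn_integral_half_exp[of 0] in auto)
  also have "\<dots> = ennreal (2 * (1 / 2))" by (subst ennreal_mult) auto
  also have "\<dots> = 1" by simp
  finally show "emeasure laplace (space laplace) = 1" .
qed

lemma measure_laplace_atMost: "measure laplace {..a} = F_tau a"
proof (cases "a < 0")
  case True
  have "emeasure laplace {..a} = (\<integral>\<^sup>+y. ennreal (exp (- y) / 2) * indicator {- a..} y \<partial>lborel)"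
    unfolding emeasure_laplace[OF borel_closed[OF closed_atMost]]
    using True by (intro nn_integral_cong) (auto simp: indicator_def)
  also have "\<dots> = ennreal (exp a / 2)" by (simp add: nn_integral_half_exp)
  finally show ?thesis using True by (simp add: measure_def F_tau_def)
next
  case False
  interpret prob_space laplace by (rule prob_space_laplace)
  have "emeasure laplace {a<..} = (\<integral>\<^sup>+y. ennreal (exp (- y) / 2) * indicator {a..} y \<partial>lborel)"
    unfolding emeasure_laplace[OF borel_open[OF open_greaterThan]]
  proof (rule nn_integral_cong_AE)
    show "AE y in lborel. (indicator {a<..} y + indicator {a<..} (- y)) * ennreal (exp (- y) / 2) * indicator {0..} y =
        ennreal (exp (- y) / 2) * indicator {a..} y"
      using AE_lborel_singleton[of a] by eventually_elim (use False in \<open>auto simp: indicator_def\<close>)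
  qed
  also have "\<dots> = ennreal (exp (- a) / 2)" by (simp add: nn_integral_half_exp)
  finally have "measure laplace {a<..} = exp (- a) / 2" by (simp add: measure_def)
  moreover have "{..a} = space laplace - {a<..}" by auto
  ultimately show ?thesis using False prob_compl[of "{a<..}"] by (simp add: F_tau_def)
qed

section \<open>The monotone transport onto a law on the line\<close>

locale real_law = prob_space M for M :: "real measure" +
  assumes sets_M [simp, measurable_cong]: "sets M = sets borel"
begin

lemma space_M [simp]: "space M = UNIV"
  using sets_eq_imp_space_eq[OF sets_M] by simp

sublocale real_distribution M
  by standard auto

text \<open>The generalized inverse is the lower adjoint of the distribution function. Monotonicity
  of U, its image law and the tail comparisons are read off this equivalence.\<close>

lemma quantile_le_iff:
  assumes "0 < t" "t < 1"
  shows "quantile M t \<le> x \<longleftrightarrow> t \<le> measure M {..x}"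
proof -
  interpret cdf_distribution M by standard
  show ?thesis
    using pseudoinverse[OF assms, of x] by (simp add: quantile_def distr_fun_def cdf_def)
qed

lemma U_map_le_iff: "U_map M x \<le> a \<longleftrightarrow> F_tau x \<le> measure M {..a}"
  unfolding U_map_def by (rule quantile_le_iff[OF F_tau_range])

lemma U_map_mono: "x \<le> y \<Longrightarrow> U_map M x \<le> U_map M y"
  using U_map_le_iff[of y "U_map M y"] F_tau_le_iff[of x y] by (simp add: U_map_le_iff)

lemma U_map_measurable [measurable]: "U_map M \<in> borel_measurable borel"
  by (intro borel_measurable_mono monoI U_map_mono)

text \<open>By adjunction the image law gives the half-line up to a the tau-mass of the points where
  \<open>F_tau\<close> is at most cdf M a. That set is again a half-line {..z} with F_tau z = cdf M
  a, except for the values 0 and 1, which \<open>F_tau\<close> does not attain.\<close>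

lemma distr_laplace_U_map: "distr laplace borel (U_map M) = M"
proof (rule cdf_unique)
  interpret L: prob_space laplace by (rule prob_space_laplace)
  have [measurable]: "U_map M \<in> measurable laplace borel"
    by (simp cong: measurable_cong_sets)
  show "real_distribution (distr laplace borel (U_map M))"
    by (intro L.real_distribution_distr) measurable
  show "real_distribution M" by (rule real_distribution_axioms)
  show "cdf (distr laplace borel (U_map M)) = cdf M"
  proof
    fix a
    have "cdf (distr laplace borel (U_map M)) a = measure laplace {x. F_tau x \<le> cdf M a}"
      by (simp add: cdf_def measure_distr vimage_def U_map_le_iff)
    also have "\<dots> = cdf M a"
    proof -
      have "0 \<le> cdf M a" "cdf M a \<le> 1" by (auto simp: cdf_def)
      then consider "cdf M a = 0" | "cdf M a = 1" | "0 < cdf M a" "cdf M a < 1" by linarith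
      then show ?thesis
      proof cases
        case 1
        then have "{x. F_tau x \<le> cdf M a} = {}" using F_tau_range by (auto simp: not_le)
        then show ?thesis using 1 by simp
      next
        case 2
        then have "{x. F_tau x \<le> cdf M a} = space laplace" using F_tau_range by (auto intro: less_imp_le)
        then show ?thesis using 2 L.prob_space by simp
      next
        case 3
        then obtain z where z: "F_tau z = cdf M a" using F_tau_surj by blast
        have "{x. F_tau x \<le> cdf M a} = {..z}" by (auto simp: F_tau_le_iff simp flip: z)
        then show ?thesis using z by (simp add: measure_laplace_atMost)
      qed
    qed
    finally show "cdf (distr laplace borel (U_map M)) a = cdf M a" .
  qed
qed

lemma nn_integral_U_map:
  fixes g :: "real \<Rightarrow> ennreal"
  assumes [measurable]: "g \<in> borel_measurable borel"
  shows "(\<integral>\<^sup>+x. g x \<partial>M) =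
    (\<integral>\<^sup>+y. (g (U_map M y) + g (U_map M (- y))) * ennreal (exp (- y) / 2) * indicator {0..} y \<partial>lborel)"
proof -
  have "(\<integral>\<^sup>+x. g x \<partial>M) = (\<integral>\<^sup>+x. g x \<partial>distr laplace borel (U_map M))"
    by (simp add: distr_laplace_U_map)
  also have "\<dots> = (\<integral>\<^sup>+x. g (U_map M x) \<partial>laplace)"
    by (rule nn_integral_distr) (auto cong: measurable_cong_sets)
  also have "\<dots> = (\<integral>\<^sup>+x. g (U_map M x) * ennreal (exp (- \<bar>x\<bar>) / 2) \<partial>lborel)"
    unfolding laplace_def by (subst nn_integral_density) (auto simp: mult.commute)
  also have "\<dots> = (\<integral>\<^sup>+y. (g (U_map M y) + g (U_map M (- y))) * ennreal (exp (- y) / 2) * indicator {0..} y \<partial>lborel)"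
    by (rule nn_integral_laplace) measurable
  finally show ?thesis .
qed

lemma nn_integral_U_map_real:
  fixes g :: "real \<Rightarrow> real"
  assumes [measurable]: "g \<in> borel_measurable borel" and g: "\<And>x. 0 \<le> g x"
  shows "(\<integral>\<^sup>+x. ennreal (g x) \<partial>M) = ennreal (1 / 2) *
    ((\<integral>\<^sup>+y. ennreal (g (U_map M y) * exp (- y)) * indicator {0..} y \<partial>lborel) +
     (\<integral>\<^sup>+y. ennreal (g (U_map M (- y)) * exp (- y)) * indicator {0..} y \<partial>lborel))"
proof -
  have "(\<integral>\<^sup>+x. ennreal (g x) \<partial>M) = (\<integral>\<^sup>+y. ennreal (1 / 2) *
      (ennreal (g (U_map M y) * exp (- y)) * indicator {0..} y +
       ennreal (g (U_map M (- y)) * exp (- y)) * indicator {0..} y) \<partial>lborel)"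
    unfolding nn_integral_U_map[of "\<lambda>x. ennreal (g x)", simplified]
  proof (intro nn_integral_cong)
    fix y :: real
    have "(ennreal u + ennreal v) * ennreal (e / 2) = ennreal (1 / 2) * (ennreal (u * e) + ennreal (v * e))"
      if "u \<ge> 0" "v \<ge> 0" "e \<ge> 0" for u v e :: real
    proof -
      have "(ennreal u + ennreal v) * ennreal (e / 2) = ennreal ((u + v) * (e / 2))"
        using that by (subst ennreal_mult) auto
      also have "(u + v) * (e / 2) = 1 / 2 * (u * e + v * e)" by (simp add: algebra_simps)
      also have "ennreal \<dots> = ennreal (1 / 2) * (ennreal (u * e) + ennreal (v * e))"
        using that by (subst ennreal_mult) auto
      finally show ?thesis .
    qed
    then show "(ennreal (g (U_map M y)) + ennreal (g (U_map M (- y)))) * ennreal (exp (- y) / 2) * indicator {0..} y =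
      ennreal (1 / 2) * (ennreal (g (U_map M y) * exp (- y)) * indicator {0..} y +
       ennreal (g (U_map M (- y)) * exp (- y)) * indicator {0..} y)"
      using g by (simp add: indicator_def)
  qed
  also have "\<dots> = ennreal (1 / 2) *
    ((\<integral>\<^sup>+y. ennreal (g (U_map M y) * exp (- y)) * indicator {0..} y \<partial>lborel) +
     (\<integral>\<^sup>+y. ennreal (g (U_map M (- y)) * exp (- y)) * indicator {0..} y \<partial>lborel))"
    by (subst nn_integral_cmult, measurable, subst nn_integral_add) measurable
  finally show ?thesis .
qed

end

section \<open>From the transport map to the log-Sobolev inequality\<close>

text \<open>The variational formula for the entropy, with optimum at a = ln Z; that a is arbitrary
  allows centring at the median. The gap is controlled by 1 + t <= exp t at t = a - ln Z.\<close>

lemma Ent_exp_le: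
  assumes "prob_space M" "integrable M (\<lambda>x. exp (f x))" "integrable M (\<lambda>x. exp (f x) * f x)"
  shows "Ent M (\<lambda>x. exp (f x)) \<le> enn2ereal (\<integral>\<^sup>+x. ennreal (exp a * psi (f x - a)) \<partial>M)"
proof -
  interpret prob_space M by fact
  define Z where "Z = (\<integral>x. exp (f x) \<partial>M)"
  have "Z > 0"
  proof -
    have "Z \<noteq> 0"
      unfolding Z_def using assms(2)
      by (subst integral_nonneg_eq_0_iff_AE) (auto simp: AE_False)
    moreover have "Z \<ge> 0" unfolding Z_def by (intro integral_nonneg_AE) auto
    ultimately show ?thesis by simp
  qed
  have "1 + (a - ln Z) \<le> exp (a - ln Z)" by (rule exp_ge_add_one_self)
  then have "(1 + (a - ln Z)) * Z \<le> exp (a - ln Z) * Z" using \<open>Z > 0\<close> by (intro mult_right_mono) auto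
  also have "\<dots> = exp a" using \<open>Z > 0\<close> by (simp add: exp_diff)
  finally have Z: "Z + a * Z - Z * ln Z \<le> exp a" by (simp add: algebra_simps)
  have eq: "exp a * psi (f x - a) = exp (f x) * f x - a * exp (f x) - exp (f x) + exp a" for x
    by (simp add: psi_def exp_diff field_simps)
  have int: "integrable M (\<lambda>x. exp a * psi (f x - a))"
    unfolding eq using assms(2,3) by auto
  have "(\<integral>x. exp a * psi (f x - a) \<partial>M) = (\<integral>x. exp (f x) * f x \<partial>M) - a * Z - Z + exp a"
    unfolding eq Z_def using assms(2,3) by (simp add: prob_space)
  then have "(\<integral>x. exp (f x) * f x \<partial>M) - Z * ln Z \<le> (\<integral>x. exp a * psi (f x - a) \<partial>M)"
    using Z by simp
  moreover have "(\<integral>\<^sup>+x. ennreal (exp a * psi (f x - a)) \<partial>M) = ennreal (\<integral>x. exp a * psi (f x - a) \<partial>M)"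
    by (rule nn_integral_eq_integral[OF int]) (auto simp: psi_nonneg)
  moreover have "(\<integral>x. exp a * psi (f x - a) \<partial>M) \<ge> 0"
    by (intro integral_nonneg_AE) (auto simp: psi_nonneg)
  ultimately show ?thesis
    using assms(3) by (simp add: Ent_def Z_def enn2ereal_ennreal)
qed

locale cost_law = young_cost H t0 A \<alpha> + real_law M
  for H :: "real \<Rightarrow> real" and t0 A \<alpha> :: real and M :: "real measure"
begin

abbreviation U :: "real \<Rightarrow> real" where "U \<equiv> U_map M"

text \<open>The sign s lets one argument serve both half-lines; for s = -1 the hypothesis is read on
  the interval from -y to -z.\<close>

lemma U_incr:
  assumes b: "b > 0" and D: "\<forall>x. \<forall>h>0. U (x + h) - U x \<le> \<theta>_inv (t0\<^sup>2 + h) / b"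
    and "\<bar>s\<bar> = 1" "0 \<le> z" "z < y"
  shows "\<bar>U (s * y) - U (s * z)\<bar> \<le> \<theta>_inv (t0\<^sup>2 + (y - z)) / b"
proof (cases "s = 1")
  case True
  then show ?thesis using D[rule_format, of "y - z" z] U_map_mono[of z y] assms by simp
next
  case False
  then have "s = -1" using assms by auto
  then show ?thesis using D[rule_format, of "y - z" "-y"] U_map_mono[of "-y" "-z"] assms by simp
qed

lemma nn_integral_U_half_le:
  fixes g :: "real \<Rightarrow> real"
  assumes "g \<in> borel_measurable borel" "\<And>x. 0 \<le> g x" "\<bar>s\<bar> = 1"
  shows "(\<integral>\<^sup>+y. ennreal (g (U (s * y)) * exp (- y)) * indicator {0..} y \<partial>lborel) \<le> 2 * (\<integral>\<^sup>+x. ennreal (g x) \<partial>M)"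
proof -
  have "2 * ennreal (1 / 2) = ennreal (2 * (1 / 2))" by (subst ennreal_mult) auto
  then have two: "2 * (ennreal (1 / 2) * x) = x" for x by (simp add: mult.assoc[symmetric])
  have "s = 1 \<or> s = -1" using assms(3) by auto
  then show ?thesis
    unfolding nn_integral_U_map_real[OF assms(1,2)] two by (auto intro: add_increasing add_increasing2)
qed

text \<open>Young's inequality with e = 1/2 bounds s |U| by a constant plus y/2, so the weight exp
  (-y) still leaves exp (-y/2).\<close>

lemma exponential_moments:
  assumes b: "b > 0" and D: "\<forall>x. \<forall>h>0. U (x + h) - U x \<le> \<theta>_inv (t0\<^sup>2 + h) / b"
  shows "\<forall>s>0. integrable M (\<lambda>x. exp (s * \<bar>x\<bar>))"
proof (intro allI impI integrableI_nonneg)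
  fix s :: real assume s: "s > 0"
  define K where "K = exp (s * \<bar>U 0\<bar> + H (s / b * 2) + t0\<^sup>2 / 2)"
  have half: "(\<integral>\<^sup>+y. ennreal (exp (s * \<bar>U (r * y)\<bar>) * exp (- y)) * indicator {0..} y \<partial>lborel) \<le> ennreal (2 * K)"
    if r: "\<bar>r\<bar> = 1" for r
  proof -
    have "exp (s * \<bar>U (r * y)\<bar>) * exp (- y) \<le> K * exp (- (1 / 2 * y))" if y: "y \<ge> 0" for y
    proof -
      have "\<bar>U (r * y) - U 0\<bar> \<le> \<theta>_inv (t0\<^sup>2 + y) / b"
      proof (cases "y = 0")
        case True
        then show ?thesis using b by (simp add: legendre_inv_nonneg)
      next
        case False
        then show ?thesis using U_incr[OF b D r, of 0 y] y by simp
      qed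
      then have "s * \<bar>U (r * y)\<bar> \<le> s * (\<bar>U 0\<bar> + \<theta>_inv (t0\<^sup>2 + y) / b)"
        using s by (intro mult_left_mono) auto
      also have "\<dots> = s * \<bar>U 0\<bar> + s / b * \<theta>_inv (t0\<^sup>2 + y)" by (simp add: algebra_simps)
      also have "s / b * \<theta>_inv (t0\<^sup>2 + y) \<le> H (s / b / (1 / 2)) + 1 / 2 * (t0\<^sup>2 + y)"
        using y by (intro mult_legendre_inv_le) auto
      finally have "s * \<bar>U (r * y)\<bar> + - y \<le> s * \<bar>U 0\<bar> + H (s / b * 2) + t0\<^sup>2 / 2 + - (1 / 2 * y)"
        by (simp add: field_simps)
      then show ?thesis unfolding K_def by (simp flip: exp_add)
    qed
    then have "(\<integral>\<^sup>+y. ennreal (exp (s * \<bar>U (r * y)\<bar>) * exp (- y)) * indicator {0..} y \<partial>lborel) \<le>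
        (\<integral>\<^sup>+y. ennreal K * (ennreal (exp (- (1 / 2 * y))) * indicator {0..} y) \<partial>lborel)"
      by (intro nn_integral_mono) (auto simp: indicator_def K_def ennreal_mult[symmetric] intro!: ennreal_leI)
    also have "\<dots> = ennreal K * ennreal (exp (- (1 / 2 * 0)) / (1 / 2))"
      by (subst nn_integral_cmult, measurable, subst nn_integral_exp_atLeast) auto
    also have "\<dots> = ennreal (2 * K)"
      by (subst ennreal_mult[symmetric]) (auto simp: K_def mult.commute)
    finally show ?thesis .
  qed
  have "(\<integral>\<^sup>+x. ennreal (exp (s * \<bar>x\<bar>)) \<partial>M) \<le> ennreal (1 / 2) * (ennreal (2 * K) + ennreal (2 * K))"
    by (subst nn_integral_U_map_real)
       (use half[of 1] half[of "-1"] in \<open>auto intro!: mult_left_mono add_mono\<close>)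
  also have "\<dots> < \<infinity>" by (simp add: ennreal_mult_less_top del: ennreal_half)
  finally show "(\<integral>\<^sup>+x. ennreal (exp (s * \<bar>x\<bar>)) \<partial>M) < \<infinity>" .
qed auto

lemma integrable_exp_bounded:
  assumes mom: "\<forall>s>0. integrable M (\<lambda>x. exp (s * \<bar>x\<bar>))"
    and [measurable]: "f \<in> borel_measurable borel"
    and f: "\<And>x. \<bar>f x\<bar> \<le> K * exp (s * \<bar>x\<bar>)"
  shows "integrable M (f :: real \<Rightarrow> real)"
proof (rule Bochner_Integration.integrable_bound)
  have "K \<ge> 0" using f[of 0] by simp
  \<comment> \<open>\<open>max s 1\<close> keeps the rate positive, as \<open>mom\<close> demands; a
    constant \<phi> with L = 0 leads to s = 0.\<close>
  show "integrable M (\<lambda>x. K * exp (max s 1 * \<bar>x\<bar>))" using mom by simp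
  show "AE x in M. norm (f x) \<le> norm (K * exp (max s 1 * \<bar>x\<bar>))"
  proof (rule AE_I2)
    fix x
    have "K * exp (s * \<bar>x\<bar>) \<le> K * exp (max s 1 * \<bar>x\<bar>)"
      using \<open>K \<ge> 0\<close> by (intro mult_left_mono) (auto intro: mult_right_mono)
    then show "norm (f x) \<le> norm (K * exp (max s 1 * \<bar>x\<bar>))"
      using f[of x] \<open>K \<ge> 0\<close> by simp
  qed
qed auto

text \<open>On each half-line F is the positive part of \<phi> (U (s y)) - \<phi> (U 0). The tangent
  at the farther point U (s y) bounds its increments by the slope there times the increment of U,
  which is the form that \<open>hardy_inequality\<close> takes. The Lipschitz bound with exponential
  moments gives the finiteness needed for absorption.\<close>

lemma psi_upper_part:
  assumes b: "b > 0" and D: "\<forall>x. \<forall>h>0. U (x + h) - U x \<le> \<theta>_inv (t0\<^sup>2 + h) / b"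
  shows "\<exists>C>0. \<forall>\<phi> d L. (\<forall>x y. \<phi> x + d x * (y - x) \<le> \<phi> y) \<longrightarrow> L-lipschitz_on UNIV \<phi> \<longrightarrow>
     d \<in> borel_measurable borel \<longrightarrow>
     (\<integral>\<^sup>+x. ennreal (psi (max (\<phi> x - \<phi> (U 0)) 0)) \<partial>M) \<le>
     ennreal C * (\<integral>\<^sup>+x. ennreal (H (8 / b * d x) * exp (\<phi> x - \<phi> (U 0))) \<partial>M)"
proof -
  obtain C where C: "C > 0" and hardy: "\<forall>F k. F \<in> borel_measurable borel \<longrightarrow> k \<in> borel_measurable borel \<longrightarrow>
       (\<forall>y. 0 \<le> F y) \<longrightarrow> (\<forall>y. 0 \<le> k y) \<longrightarrow> F 0 = 0 \<longrightarrow>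
       (\<forall>z\<ge>0. \<forall>y>z. F y \<le> F z + k y * \<theta>_inv (t0\<^sup>2 + (y - z)) / b) \<longrightarrow>
       (\<integral>\<^sup>+y. ennreal (psi (F y) * exp (- y)) * indicator {0..} y \<partial>lborel) < \<infinity> \<longrightarrow>
       (\<integral>\<^sup>+y. ennreal (psi (F y) * exp (- y)) * indicator {0..} y \<partial>lborel) \<le>
       ennreal C * (\<integral>\<^sup>+y. ennreal (H (8 / b * k y) * exp (F y) * exp (- y)) * indicator {0..} y \<partial>lborel)"
    using hardy_inequality[OF b] by (elim exE conjE) (rule that)
  have "(\<integral>\<^sup>+x. ennreal (psi (max (\<phi> x - \<phi> (U 0)) 0)) \<partial>M) \<le>
     ennreal C * (\<integral>\<^sup>+x. ennreal (H (8 / b * d x) * exp (\<phi> x - \<phi> (U 0))) \<partial>M)"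
    if tangent: "\<And>x y. \<phi> x + d x * (y - x) \<le> \<phi> y" and L: "L-lipschitz_on UNIV \<phi>"
      and [measurable]: "d \<in> borel_measurable borel" for \<phi> d L
  proof -
    define a where "a = \<phi> (U 0)"
    have [measurable]: "\<phi> \<in> borel_measurable borel"
      using lipschitz_on_continuous_on[OF L] by (rule borel_measurable_continuous_onI)
    have L0: "L \<ge> 0" using lipschitz_on_nonneg[OF L] .
    have lip: "\<bar>\<phi> x - a\<bar> \<le> L * \<bar>x - U 0\<bar>" for x
      using lipschitz_onD[OF L, of x "U 0"] by (simp add: dist_real_def a_def)
    have [measurable]: "(\<lambda>x. psi (max (\<phi> x - a) 0)) \<in> borel_measurable borel" by measurable
    have "integrable M (\<lambda>x. psi (max (\<phi> x - a) 0))"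
    proof (rule integrable_exp_bounded[OF exponential_moments[OF b D]])
      fix x
      define F where "F = max (\<phi> x - a) 0"
      have F: "0 \<le> F" "F \<le> L * (\<bar>x\<bar> + \<bar>U 0\<bar>)"
        using lip[of x] mult_left_mono[OF abs_triangle_ineq4, of L x "U 0"] L0
        by (auto simp: F_def)
      have "psi F \<le> F * exp F" by (rule psi_le_mult_exp[OF F(1)])
      also have "\<dots> \<le> exp F * exp F"
        using exp_ge_add_one_self[of F] by (intro mult_right_mono) (auto simp del: exp_ge_add_one_self)
      also have "\<dots> \<le> exp (2 * (L * (\<bar>x\<bar> + \<bar>U 0\<bar>)))" using F by (simp flip: exp_add)
      also have "\<dots> = exp (2 * L * \<bar>U 0\<bar>) * exp (2 * L * \<bar>x\<bar>)" by (simp add: algebra_simps flip: exp_add)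
      finally show "\<bar>psi (max (\<phi> x - a) 0)\<bar> \<le> exp (2 * L * \<bar>U 0\<bar>) * exp (2 * L * \<bar>x\<bar>)"
        by (simp add: F_def psi_nonneg)
    qed auto
    then have fin: "(\<integral>\<^sup>+x. ennreal (psi (max (\<phi> x - a) 0)) \<partial>M) < \<infinity>"
      by (subst nn_integral_eq_integral) (auto simp: psi_nonneg)
    have half: "(\<integral>\<^sup>+y. ennreal (psi (max (\<phi> (U (s * y)) - a) 0) * exp (- y)) * indicator {0..} y \<partial>lborel) \<le>
      ennreal C * (\<integral>\<^sup>+y. ennreal (H (8 / b * d (U (s * y))) * exp (\<phi> (U (s * y)) - a) * exp (- y)) * indicator {0..} y \<partial>lborel)"
      if s: "\<bar>s\<bar> = 1" for s
    proof -
      define F where "F y = max (\<phi> (U (s * y)) - a) 0" for y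
      \<comment> \<open>Where F = 0 the factor exp (F y) = 1 may exceed exp (\<phi> - a); setting k
        = 0 there makes the H-term vanish.\<close>
      define k where "k y = (if F y > 0 then \<bar>d (U (s * y))\<bar> else 0)" for y
      have [measurable]: "F \<in> borel_measurable borel" unfolding F_def by measurable
      have [measurable]: "k \<in> borel_measurable borel" unfolding k_def by measurable
      have "(\<integral>\<^sup>+y. ennreal (psi (F y) * exp (- y)) * indicator {0..} y \<partial>lborel) \<le>
         ennreal C * (\<integral>\<^sup>+y. ennreal (H (8 / b * k y) * exp (F y) * exp (- y)) * indicator {0..} y \<partial>lborel)"
      proof (rule hardy[rule_format])
        fix z y :: real assume zy: "z \<ge> 0" "y > z"
        have F_nonneg: "0 \<le> F z" by (simp add: F_def)
        show "F y \<le> F z + k y * \<theta>_inv (t0\<^sup>2 + (y - z)) / b"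
        proof (cases "F y > 0")
          case False
          then show ?thesis using F_nonneg by (simp add: k_def)
        next
          case True
          have "F y = \<phi> (U (s * y)) - a" using True by (auto simp: F_def max_def split: if_splits)
          moreover have "\<phi> (U (s * z)) - a \<le> F z" by (simp add: F_def)
          ultimately have "F y - F z \<le> \<phi> (U (s * y)) - \<phi> (U (s * z))" by simp
          also have "\<dots> \<le> d (U (s * y)) * (U (s * y) - U (s * z))"
            using tangent[of "U (s * y)" "U (s * z)"] by (simp add: algebra_simps)
          also have "\<dots> \<le> \<bar>d (U (s * y))\<bar> * \<bar>U (s * y) - U (s * z)\<bar>"
            using abs_ge_self by (metis abs_mult)
          also have "\<dots> \<le> \<bar>d (U (s * y))\<bar> * (\<theta>_inv (t0\<^sup>2 + (y - z)) / b)"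
            using U_incr[OF b D s zy] by (intro mult_left_mono) auto
          finally show ?thesis using True by (simp add: k_def)
        qed
      next
        have "(\<integral>\<^sup>+y. ennreal (psi (F y) * exp (- y)) * indicator {0..} y \<partial>lborel) \<le>
            2 * (\<integral>\<^sup>+x. ennreal (psi (max (\<phi> x - a) 0)) \<partial>M)"
          unfolding F_def by (rule nn_integral_U_half_le[OF _ _ s]) (auto simp: psi_nonneg)
        also have "\<dots> < \<infinity>" using fin by (simp add: ennreal_mult_less_top)
        finally show "(\<integral>\<^sup>+y. ennreal (psi (F y) * exp (- y)) * indicator {0..} y \<partial>lborel) < \<infinity>" .
      qed (auto simp: F_def k_def a_def)
      also have "\<dots> \<le> ennreal C * (\<integral>\<^sup>+y. ennreal (H (8 / b * d (U (s * y))) * exp (\<phi> (U (s * y)) - a) * exp (- y)) * indicator {0..} y \<partial>lborel)"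
      proof (intro mult_left_mono nn_integral_mono mult_right_mono ennreal_leI)
        fix y
        show "H (8 / b * k y) * exp (F y) \<le> H (8 / b * d (U (s * y))) * exp (\<phi> (U (s * y)) - a)"
        proof (cases "F y > 0")
          case True
          then have "F y = \<phi> (U (s * y)) - a" by (auto simp: F_def max_def split: if_splits)
          moreover have "H (8 / b * k y) \<le> H (8 / b * d (U (s * y)))"
            by (rule H_mono) (use True in \<open>simp add: k_def abs_mult\<close>)
          ultimately show ?thesis by (auto intro: mult_right_mono)
        qed (auto simp: k_def H_nonneg)
      qed auto
      finally show ?thesis by (simp add: F_def)
    qed
    have "(\<integral>\<^sup>+x. ennreal (psi (max (\<phi> x - a) 0)) \<partial>M) = ennreal (1 / 2) *
       ((\<integral>\<^sup>+y. ennreal (psi (max (\<phi> (U (1 * y)) - a) 0) * exp (- y)) * indicator {0..} y \<partial>lborel) +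
        (\<integral>\<^sup>+y. ennreal (psi (max (\<phi> (U (- 1 * y)) - a) 0) * exp (- y)) * indicator {0..} y \<partial>lborel))"
      by (subst nn_integral_U_map_real) (auto simp: psi_nonneg)
    also have "\<dots> \<le> ennreal (1 / 2) *
       (ennreal C * (\<integral>\<^sup>+y. ennreal (H (8 / b * d (U (1 * y))) * exp (\<phi> (U (1 * y)) - a) * exp (- y)) * indicator {0..} y \<partial>lborel) +
        ennreal C * (\<integral>\<^sup>+y. ennreal (H (8 / b * d (U (- 1 * y))) * exp (\<phi> (U (- 1 * y)) - a) * exp (- y)) * indicator {0..} y \<partial>lborel))"
      by (intro mult_left_mono add_mono half) auto
    also have "\<dots> = ennreal C * (\<integral>\<^sup>+x. ennreal (H (8 / b * d x) * exp (\<phi> x - a)) \<partial>M)"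
      by (subst nn_integral_U_map_real) (auto simp: H_nonneg distrib_left mult.left_commute)
    finally show ?thesis by (simp add: a_def)
  qed
  then show ?thesis using C by (intro exI[of _ C]) auto
qed

text \<open>Below the median value, the tangent at the median m bounds psi by the smaller of 1 and
  (d m)^2 (x - m)^2. After integration this is at most a multiple of H (8 d(m) / b), which in turn
  is dominated by the right-hand side on the side of m where \<phi> increases.\<close>

lemma psi_lower_part:
  assumes b: "b > 0" and mom: "\<forall>s>0. integrable M (\<lambda>x. exp (s * \<bar>x\<bar>))"
  shows "\<exists>C>0. \<forall>\<phi> d. (\<forall>x y. \<phi> x + d x * (y - x) \<le> \<phi> y) \<longrightarrow>
     \<phi> \<in> borel_measurable borel \<longrightarrow> d \<in> borel_measurable borel \<longrightarrow>
     (\<integral>\<^sup>+x. ennreal (psi (min (\<phi> x - \<phi> (U 0)) 0)) \<partial>M) \<le>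
     ennreal C * (\<integral>\<^sup>+x. ennreal (H (8 / b * d x) * exp (\<phi> x - \<phi> (U 0))) \<partial>M)"
proof -
  define v where "v = (\<integral>x. (x - U 0)\<^sup>2 \<partial>M)"
  have int_v: "integrable M (\<lambda>x. (x - U 0)\<^sup>2)"
  proof (rule integrable_exp_bounded[OF mom])
    fix x
    have "\<bar>x - U 0\<bar> \<le> exp (\<bar>x\<bar> + \<bar>U 0\<bar>)"
      using exp_ge_add_one_self[of "\<bar>x\<bar> + \<bar>U 0\<bar>"] by linarith
    then have "(x - U 0)\<^sup>2 \<le> (exp (\<bar>x\<bar> + \<bar>U 0\<bar>))\<^sup>2" by (rule power2_le_iff_abs_le[THEN iffD2, rotated]) simp
    also have "\<dots> = exp (2 * \<bar>U 0\<bar>) * exp (2 * \<bar>x\<bar>)"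
      by (simp add: power2_eq_square flip: exp_add)
    finally show "\<bar>(x - U 0)\<^sup>2\<bar> \<le> exp (2 * \<bar>U 0\<bar>) * exp (2 * \<bar>x\<bar>)" by simp
  qed auto
  have v: "v \<ge> 0" unfolding v_def by (intro integral_nonneg_AE) auto
  \<comment> \<open>In the quadratic range H (8q/b) = 16 q^2 / b^2, which gives the first entry;
    beyond it H >= t0^2 gives the second.\<close>
  define C where "C = max (v * b\<^sup>2 / 16) (1 / t0\<^sup>2)"
  have C: "C > 0" using t0_pos by (simp add: C_def less_max_iff_disj)
  have Cq: "min 1 (q\<^sup>2 * v) \<le> C * H (8 / b * q)" for q
  proof (cases "\<bar>8 / b * q\<bar> \<le> 2 * t0")
    case True
    have "q\<^sup>2 * v = v * b\<^sup>2 / 16 * H (8 / b * q)"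
      using b by (subst H_quad[OF True]) (simp add: power2_eq_square)
    also have "\<dots> \<le> C * H (8 / b * q)" using H_nonneg by (intro mult_right_mono) (auto simp: C_def)
    finally show ?thesis by simp
  next
    case False
    have "1 = 1 / t0\<^sup>2 * t0\<^sup>2" using t0_pos by simp
    also have "\<dots> \<le> C * H (8 / b * q)"
      using False C by (intro mult_mono H_ge_t0) (auto simp: C_def)
    finally show ?thesis by simp
  qed
  have "(\<integral>\<^sup>+x. ennreal (psi (min (\<phi> x - \<phi> (U 0)) 0)) \<partial>M) \<le>
     ennreal (2 * C) * (\<integral>\<^sup>+x. ennreal (H (8 / b * d x) * exp (\<phi> x - \<phi> (U 0))) \<partial>M)"
    if tangent: "\<And>x y. \<phi> x + d x * (y - x) \<le> \<phi> y" 
      and [measurable]: "\<phi> \<in> borel_measurable borel" "d \<in> borel_measurable borel" for \<phi> d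
  proof -
    define m where "m = U 0"
    define R where "R = (\<integral>\<^sup>+x. ennreal (H (8 / b * d x) * exp (\<phi> x - \<phi> m)) \<partial>M)"
    have le1: "psi (min (\<phi> x - \<phi> m) 0) \<le> 1" for x
      using psi_neg_le_one[of "- min (\<phi> x - \<phi> m) 0"] by simp
    have le2: "psi (min (\<phi> x - \<phi> m) 0) \<le> (d m)\<^sup>2 * (x - m)\<^sup>2" for x
    proof (cases "\<phi> x \<le> \<phi> m")
      case True
      have "psi (min (\<phi> x - \<phi> m) 0) \<le> (\<phi> m - \<phi> x)\<^sup>2"
        using psi_neg_le_square[of "\<phi> m - \<phi> x"] True by (simp add: min_def)
      also have "\<dots> \<le> (d m * (x - m))\<^sup>2"
        using tangent[of m x] True by (intro abs_le_square_iff[THEN iffD1]) auto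
      finally show ?thesis by (simp add: power_mult_distrib)
    qed (simp add: min_def)
    have "(\<integral>\<^sup>+x. ennreal (psi (min (\<phi> x - \<phi> m) 0)) \<partial>M) \<le> (\<integral>\<^sup>+x. ennreal 1 \<partial>M)"
      by (intro nn_integral_mono ennreal_leI le1)
    then have I1: "(\<integral>\<^sup>+x. ennreal (psi (min (\<phi> x - \<phi> m) 0)) \<partial>M) \<le> ennreal 1"
      using emeasure_space_1 by simp
    have "(\<integral>\<^sup>+x. ennreal (psi (min (\<phi> x - \<phi> m) 0)) \<partial>M) \<le> (\<integral>\<^sup>+x. ennreal ((d m)\<^sup>2 * (x - m)\<^sup>2) \<partial>M)"
      by (intro nn_integral_mono ennreal_leI le2)
    also have "\<dots> = ennreal ((d m)\<^sup>2 * v)"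
      using int_v by (subst nn_integral_eq_integral) (auto simp: v_def m_def)
    finally have "(\<integral>\<^sup>+x. ennreal (psi (min (\<phi> x - \<phi> m) 0)) \<partial>M) \<le> ennreal (min 1 ((d m)\<^sup>2 * v))"
      using I1 by (simp add: min_def)
    also have "\<dots> \<le> ennreal (C * H (8 / b * d m))" by (rule ennreal_leI[OF Cq])
    also have "\<dots> = ennreal C * ennreal (H (8 / b * d m))"
      using C H_nonneg by (subst ennreal_mult) auto
    also have "ennreal (H (8 / b * d m)) \<le> 2 * R"
    proof -
      \<comment> \<open>The direction in which \<phi> does not decrease from m: there \<phi> >=
        \<phi> m and, by monotone slopes, |d| >= |d m|. The integral of exp (-y) over the half-line
        is 1, and returning to M costs a factor 2.\<close>
      define s where "s = (if d m \<ge> 0 then 1 else - 1 :: real)"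
      have s: "\<bar>s\<bar> = 1" by (simp add: s_def)
      have pw: "H (8 / b * d m) \<le> H (8 / b * d (U (s * y))) * exp (\<phi> (U (s * y)) - \<phi> m)" if y: "y \<ge> 0" for y
      proof -
        define x where "x = U (s * y)"
        have x: "0 \<le> d m * (x - m)" 
          unfolding x_def m_def s_def using U_map_mono[of 0 y] U_map_mono[of "- y" 0] y
          by (auto intro: mult_nonneg_nonneg mult_nonpos_nonpos)
        have "\<bar>d m\<bar> \<le> \<bar>d x\<bar>"
        proof (cases "x = m")
          case False
          have "(d x - d m) * (x - m) \<ge> 0"
            using tangent[of m x] tangent[of x m] by (simp add: algebra_simps)
          then show ?thesis using x False by (auto simp: zero_le_mult_iff)
        qed simp
        then have "\<bar>8 / b * d m\<bar> \<le> \<bar>8 / b * d x\<bar>" using b by (simp add: abs_mult divide_right_mono)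
        then have "H (8 / b * d m) * 1 \<le> H (8 / b * d x) * exp (\<phi> x - \<phi> m)"
          using tangent[of m x] x by (intro mult_mono H_mono) (auto simp: H_nonneg)
        then show ?thesis by (simp add: x_def)
      qed
      have "ennreal (H (8 / b * d m)) = ennreal (H (8 / b * d m)) * ennreal (exp (- (1 * 0)) / 1)" by simp
      also have "\<dots> = (\<integral>\<^sup>+y. ennreal (H (8 / b * d m)) * (ennreal (exp (- (1 * y))) * indicator {0..} y) \<partial>lborel)"
        by (subst nn_integral_cmult, measurable, subst nn_integral_exp_atLeast) auto
      also have "\<dots> \<le> (\<integral>\<^sup>+y. ennreal (H (8 / b * d (U (s * y))) * exp (\<phi> (U (s * y)) - \<phi> m) * exp (- y)) * indicator {0..} y \<partial>lborel)"
        using pw by (intro nn_integral_mono)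
          (auto simp: indicator_def H_nonneg ennreal_mult[symmetric] intro!: ennreal_leI mult_right_mono)
      also have "\<dots> \<le> 2 * R"
        unfolding R_def by (rule nn_integral_U_half_le[OF _ _ s]) (auto simp: H_nonneg)
      finally show ?thesis .
    qed
    finally have "(\<integral>\<^sup>+x. ennreal (psi (min (\<phi> x - \<phi> m) 0)) \<partial>M) \<le> ennreal C * (2 * R)"
      by (simp add: mult_left_mono)
    also have "\<dots> = ennreal (2 * C) * R"
      using C by (simp add: ennreal_mult mult.assoc mult.left_commute)
    finally show ?thesis by (simp add: R_def m_def)
  qed
  then show ?thesis using C by (intro exI[of _ "2 * C"]) auto
qed

text \<open>\<open>Ent_exp_le\<close> at a = \<phi> (U 0) leaves psi (\<phi> - a), split by the sign
  of \<phi> - a. The resulting constant is enlarged to C >= 1 so that \<open>H_scale\<close> moves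
  it into the argument of H, hence c = 8C/b.\<close>

lemma modified_log_sobolev:
  assumes b: "b > 0" and D: "\<forall>x. \<forall>h>0. U (x + h) - U x \<le> \<theta>_inv (t0\<^sup>2 + h) / b"
  shows "\<exists>c>0. \<forall>\<phi> d L. convex_on UNIV \<phi> \<longrightarrow> L-lipschitz_on UNIV \<phi> \<longrightarrow>
     (\<forall>x. (\<phi> has_real_derivative d x) (at x)) \<longrightarrow> d \<in> borel_measurable borel \<longrightarrow>
     Ent M (\<lambda>x. exp (\<phi> x)) \<le> enn2ereal (\<integral>\<^sup>+x. ennreal (H (c * d x) * exp (\<phi> x)) \<partial>M)"
proof -
  note mom = exponential_moments[OF b D]
  obtain C1 where C1: "C1 > 0" and up: "\<forall>\<phi> d L. (\<forall>x y. \<phi> x + d x * (y - x) \<le> \<phi> y) \<longrightarrow> L-lipschitz_on UNIV \<phi> \<longrightarrow>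
     d \<in> borel_measurable borel \<longrightarrow>
     (\<integral>\<^sup>+x. ennreal (psi (max (\<phi> x - \<phi> (U 0)) 0)) \<partial>M) \<le>
     ennreal C1 * (\<integral>\<^sup>+x. ennreal (H (8 / b * d x) * exp (\<phi> x - \<phi> (U 0))) \<partial>M)"
    using psi_upper_part[OF b D] by (elim exE conjE) (rule that)
  obtain C2 where C2: "C2 > 0" and low: "\<forall>\<phi> d. (\<forall>x y. \<phi> x + d x * (y - x) \<le> \<phi> y) \<longrightarrow>
     \<phi> \<in> borel_measurable borel \<longrightarrow> d \<in> borel_measurable borel \<longrightarrow>
     (\<integral>\<^sup>+x. ennreal (psi (min (\<phi> x - \<phi> (U 0)) 0)) \<partial>M) \<le>
     ennreal C2 * (\<integral>\<^sup>+x. ennreal (H (8 / b * d x) * exp (\<phi> x - \<phi> (U 0))) \<partial>M)"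
    using psi_lower_part[OF b mom] by (elim exE conjE) (rule that)
  define C where "C = max 1 (C1 + C2)"
  have C: "C \<ge> 1" by (simp add: C_def)
  have "Ent M (\<lambda>x. exp (\<phi> x)) \<le> enn2ereal (\<integral>\<^sup>+x. ennreal (H (C * (8 / b) * d x) * exp (\<phi> x)) \<partial>M)"
    if conv: "convex_on UNIV \<phi>" and L: "L-lipschitz_on UNIV \<phi>"
      and d: "\<And>x. (\<phi> has_real_derivative d x) (at x)" and [measurable]: "d \<in> borel_measurable borel" for \<phi> d L
  proof -
    define a where "a = \<phi> (U 0)"
    have [measurable]: "\<phi> \<in> borel_measurable borel"
      using lipschitz_on_continuous_on[OF L] by (rule borel_measurable_continuous_onI)
    have tangent: "\<phi> x + d x * (y - x) \<le> \<phi> y" for x y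
      using convex_on_imp_above_tangent[OF conv, of x y "d x"] d[of x] by simp
    have L0: "L \<ge> 0" using lipschitz_on_nonneg[OF L] .
    have lip: "\<bar>\<phi> x\<bar> \<le> \<bar>\<phi> 0\<bar> + L * \<bar>x\<bar>" for x
      using lipschitz_onD[OF L, of x 0] by (simp add: dist_real_def)
    have int1: "integrable M (\<lambda>x. exp (\<phi> x))"
    proof (rule integrable_exp_bounded[OF mom])
      show "\<bar>exp (\<phi> x)\<bar> \<le> exp \<bar>\<phi> 0\<bar> * exp (L * \<bar>x\<bar>)" for x
        using lip[of x] by (simp flip: exp_add)
    qed auto
    have int2: "integrable M (\<lambda>x. exp (\<phi> x) * \<phi> x)"
    proof (rule integrable_exp_bounded[OF mom])
      fix x
      have "\<bar>exp (\<phi> x) * \<phi> x\<bar> \<le> exp \<bar>\<phi> x\<bar> * exp \<bar>\<phi> x\<bar>"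
        unfolding abs_mult using exp_ge_add_one_self[of "\<bar>\<phi> x\<bar>"] by (intro mult_mono) (auto simp del: exp_ge_add_one_self)
      also have "\<dots> \<le> exp (2 * \<bar>\<phi> 0\<bar>) * exp (2 * L * \<bar>x\<bar>)"
        using lip[of x] by (simp flip: exp_add)
      finally show "\<bar>exp (\<phi> x) * \<phi> x\<bar> \<le> exp (2 * \<bar>\<phi> 0\<bar>) * exp (2 * L * \<bar>x\<bar>)" .
    qed auto
    define R where "R = (\<integral>\<^sup>+x. ennreal (H (8 / b * d x) * exp (\<phi> x - a)) \<partial>M)"
    have "(\<integral>\<^sup>+x. ennreal (psi (\<phi> x - a)) \<partial>M) =
       (\<integral>\<^sup>+x. ennreal (psi (max (\<phi> x - a) 0)) + ennreal (psi (min (\<phi> x - a) 0)) \<partial>M)"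
      by (intro nn_integral_cong) (auto simp: max_def min_def)
    also have "\<dots> = (\<integral>\<^sup>+x. ennreal (psi (max (\<phi> x - a) 0)) \<partial>M) + (\<integral>\<^sup>+x. ennreal (psi (min (\<phi> x - a) 0)) \<partial>M)"
      by (rule nn_integral_add) auto
    also have "\<dots> \<le> ennreal C1 * R + ennreal C2 * R"
      unfolding R_def a_def by (intro add_mono up[rule_format, OF tangent L] low[rule_format, OF tangent]) auto
    also have "\<dots> = ennreal (C1 + C2) * R" using C1 C2 by (simp add: distrib_right)
    also have "\<dots> \<le> ennreal C * R" by (intro mult_right_mono ennreal_leI) (auto simp: C_def)
    finally have main: "(\<integral>\<^sup>+x. ennreal (psi (\<phi> x - a)) \<partial>M) \<le> ennreal C * R" .
    have "(\<integral>\<^sup>+x. ennreal (exp a * psi (\<phi> x - a)) \<partial>M) = ennreal (exp a) * (\<integral>\<^sup>+x. ennreal (psi (\<phi> x - a)) \<partial>M)"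
      by (simp add: ennreal_mult psi_nonneg nn_integral_cmult)
    also have "\<dots> \<le> ennreal (exp a) * (ennreal C * R)" by (intro mult_left_mono main) auto
    also have "\<dots> = (\<integral>\<^sup>+x. ennreal (exp a) * (ennreal C * ennreal (H (8 / b * d x) * exp (\<phi> x - a))) \<partial>M)"
      unfolding R_def by (simp add: nn_integral_cmult)
    also have "\<dots> \<le> (\<integral>\<^sup>+x. ennreal (H (C * (8 / b) * d x) * exp (\<phi> x)) \<partial>M)"
    proof (intro nn_integral_mono)
      fix x
      have "exp a * (C * (H (8 / b * d x) * exp (\<phi> x - a))) = C * H (8 / b * d x) * exp (\<phi> x)"
        by (simp add: exp_diff)
      also have "\<dots> \<le> H (C * (8 / b * d x)) * exp (\<phi> x)"
        by (intro mult_right_mono H_scale C) auto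
      finally show "ennreal (exp a) * (ennreal C * ennreal (H (8 / b * d x) * exp (\<phi> x - a)))
         \<le> ennreal (H (C * (8 / b) * d x) * exp (\<phi> x))"
        using C by (simp add: ennreal_mult[symmetric] H_nonneg mult.assoc)
    qed
    finally have "(\<integral>\<^sup>+x. ennreal (exp a * psi (\<phi> x - a)) \<partial>M) \<le> (\<integral>\<^sup>+x. ennreal (H (C * (8 / b) * d x) * exp (\<phi> x)) \<partial>M)" .
    then show ?thesis
      using Ent_exp_le[OF prob_space_axioms int1 int2, of a]
      by (meson less_eq_ennreal.rep_eq order_trans)
  qed
  then show ?thesis using C b by (intro exI[of _ "C * (8 / b)"]) auto
qed

end

section \<open>Smooth convex approximation of hinges\<close>

definition sigmoid :: "real \<Rightarrow> real" where
  "sigmoid t = 1 / (1 + exp (- t))"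

lemma sigmoid_pos: "0 < sigmoid t" and sigmoid_less_1: "sigmoid t < 1"
  by (auto simp: sigmoid_def add_pos_pos)

lemma sigmoid_mono: "t \<le> r \<Longrightarrow> sigmoid t \<le> sigmoid r"
  by (auto simp: sigmoid_def intro!: divide_left_mono mult_pos_pos add_pos_pos)

lemma has_real_derivative_sigmoid:
  "(sigmoid has_real_derivative sigmoid t * (1 - sigmoid t)) (at t)"
proof -
  have "1 + exp (- t) > 0" by (simp add: add_pos_pos)
  then show ?thesis
    unfolding sigmoid_def [abs_def]
    by (auto intro!: derivative_eq_intros simp: field_simps power2_eq_square)
qed

lemma has_real_derivative_ln_1_plus_exp:
  "((\<lambda>t. ln (1 + exp t)) has_real_derivative sigmoid t) (at t)"
proof -
  have "1 + exp t > 0" by (simp add: add_pos_pos)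
  moreover have "exp t / (1 + exp t) = sigmoid t"
    by (simp add: sigmoid_def exp_minus field_simps)
  ultimately show ?thesis
    by (auto intro!: derivative_eq_intros)
qed

lemma ln_1_plus_exp_bounds:
  fixes t :: real
  shows "max t 0 \<le> ln (1 + exp t)" "ln (1 + exp t) \<le> max t 0 + ln 2"
proof -
  have "exp (max t 0) \<le> 1 + exp t" by (auto simp: max_def)
  then show "max t 0 \<le> ln (1 + exp t)" by (subst ln_ge_iff) (auto simp: add_pos_pos)
  have "1 + exp t \<le> 2 * exp (max t 0)"
    by (auto simp: max_def)
  then have "ln (1 + exp t) \<le> ln (2 * exp (max t 0))"
    by (subst ln_le_cancel_iff) (auto simp: add_pos_pos)
  then show "ln (1 + exp t) \<le> max t 0 + ln 2" by (simp add: ln_mult)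
qed

text \<open>If g' is a polynomial in g, the polynomials in g are closed under differentiation: the
  derivative of p(g) is p'(g) r(g). This yields all derivatives of the hinges at once.\<close>

lemma smoothI_deriv_poly:
  assumes f: "\<And>x. (f has_real_derivative poly q (g x)) (at x)"
    and g: "\<And>x. (g has_real_derivative poly r (g x)) (at x)"
  shows "smooth f"
proof -
  have poly_g: "((\<lambda>x. poly p (g x)) has_real_derivative poly (pderiv p * r) (g x)) (at x)" for p x
    using DERIV_chain2[OF poly_DERIV g] by simp
  have "\<exists>p. (deriv ^^ k) (\<lambda>x. poly q (g x)) = (\<lambda>x. poly p (g x))" for k
  proof (induction k)
    case (Suc k)
    then obtain p where "(deriv ^^ k) (\<lambda>x. poly q (g x)) = (\<lambda>x. poly p (g x))" by blast
    then show ?case using DERIV_imp_deriv[OF poly_g] by (auto intro!: exI[of _ "pderiv p * r"])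
  qed auto
  then have diff: "((deriv ^^ k) (\<lambda>x. poly q (g x))) differentiable (at x)" for k x
    using poly_g real_differentiable_def by metis
  have "deriv f = (\<lambda>x. poly q (g x))"
    using DERIV_imp_deriv[OF f] by auto
  \<comment> \<open>For k > 0 the k-th derivative of f is the (k - 1)-st of the polynomial in
    g.\<close>
  then have "((deriv ^^ k) f) differentiable (at x)" for k x
    using diff[of "k - 1" x] f[of x] real_differentiable_def
    by (cases k) (auto simp: funpow_swap1[symmetric] funpow_Suc_right simp del: funpow.simps)
  then show ?thesis by (simp add: smooth_def)
qed

text \<open>The shift by \<open>Suc n\<close> makes the derivative vanish in the limit also at the kink \<open>w = 0\<close>,
  which may carry an atom.\<close>

definition soft_hinge :: "nat \<Rightarrow> real \<Rightarrow> real" where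
  "soft_hinge n w = ln (1 + exp ((real (Suc n))\<^sup>2 * w - real (Suc n))) / (real (Suc n))\<^sup>2"

definition soft_step :: "nat \<Rightarrow> real \<Rightarrow> real" where
  "soft_step n w = sigmoid ((real (Suc n))\<^sup>2 * w - real (Suc n))"

lemma has_real_derivative_soft_hinge:
  "(soft_hinge n has_real_derivative soft_step n w) (at w)"
proof -
  define N where "N = real (Suc n)"
  have N: "N > 0" by (simp add: N_def)
  have "((\<lambda>w. ln (1 + exp (N\<^sup>2 * w - N))) has_real_derivative
      sigmoid (N\<^sup>2 * w - N) * N\<^sup>2) (at w)"
    by (rule DERIV_chain2[OF has_real_derivative_ln_1_plus_exp]) (auto intro!: derivative_eq_intros)
  from DERIV_cdivide[OF this, of "N\<^sup>2"] show ?thesis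
    using N unfolding soft_hinge_def [abs_def] soft_step_def N_def by simp
qed

lemma has_real_derivative_soft_step:
  "(soft_step n has_real_derivative (real (Suc n))\<^sup>2 * (soft_step n w * (1 - soft_step n w))) (at w)"
proof -
  define N where "N = real (Suc n)"
  have "((\<lambda>w. sigmoid (N\<^sup>2 * w - N)) has_real_derivative
      sigmoid (N\<^sup>2 * w - N) * (1 - sigmoid (N\<^sup>2 * w - N)) * N\<^sup>2) (at w)"
    by (rule DERIV_chain2[OF has_real_derivative_sigmoid]) (auto intro!: derivative_eq_intros)
  then show ?thesis unfolding soft_step_def [abs_def] N_def by (simp add: mult.commute)
qed

lemma soft_step_mono: "v \<le> w \<Longrightarrow> soft_step n v \<le> soft_step n w"
  unfolding soft_step_def by (intro sigmoid_mono diff_right_mono mult_left_mono) auto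

lemma soft_hinge_nonneg: "0 \<le> soft_hinge n w"
  unfolding soft_hinge_def using ln_1_plus_exp_bounds(1) by (intro divide_nonneg_nonneg) (auto simp: max_def split: if_splits)

lemma soft_hinge_le: "soft_hinge n w \<le> \<bar>w\<bar> + 1"
proof -
  define N where "N = real (Suc n)"
  have N: "N \<ge> 1" by (simp add: N_def)
  then have N2: "N\<^sup>2 \<ge> 1" by (simp add: one_le_power)
  have "ln (1 + exp (N\<^sup>2 * w - N)) \<le> max (N\<^sup>2 * w - N) 0 + ln 2" by (rule ln_1_plus_exp_bounds)
  also have "\<dots> \<le> N\<^sup>2 * \<bar>w\<bar> + N\<^sup>2"
  proof -
    have "N\<^sup>2 * w \<le> N\<^sup>2 * \<bar>w\<bar>" by (intro mult_left_mono) auto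
    moreover have "ln 2 \<le> (1::real)" using ln_le_minus_one[of "2::real"] by simp
    moreover have "0 \<le> N\<^sup>2 * \<bar>w\<bar>" by simp
    ultimately show ?thesis using N N2 by linarith
  qed
  finally show ?thesis
    using N2 unfolding soft_hinge_def N_def by (simp add: field_simps)
qed

text \<open>The shift lowers the hinge by at most 1/N, and the smoothing raises it by at most ln 2 /
  N^2.\<close>

lemma tendsto_soft_hinge: "(\<lambda>n. soft_hinge n w) \<longlonglongrightarrow> max w 0"
proof (rule tendsto_sandwich)
  define N where "N n = real (Suc n)" for n
  have N: "N n > 0" for n by (simp add: N_def)
  have eq: "max ((N n)\<^sup>2 * w - N n) 0 / (N n)\<^sup>2 = max (w - 1 / N n) 0" for n
  proof -
    have "((N n)\<^sup>2 * w - N n) / (N n)\<^sup>2 = w - 1 / N n"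
      using N[of n] by (simp add: field_simps power2_eq_square)
    moreover have "max a 0 / (N n)\<^sup>2 = max (a / (N n)\<^sup>2) 0" for a
      by (auto simp: max_def divide_le_0_iff zero_le_divide_iff)
    ultimately show ?thesis by metis
  qed
  show "eventually (\<lambda>n. max (w - 1 / N n) 0 \<le> soft_hinge n w) sequentially"
    unfolding soft_hinge_def N_def[symmetric] eq[symmetric]
    by (intro always_eventually allI divide_right_mono ln_1_plus_exp_bounds) simp
  show "eventually (\<lambda>n. soft_hinge n w \<le> max (w - 1 / N n) 0 + ln 2 / (N n)\<^sup>2) sequentially"
    unfolding soft_hinge_def N_def[symmetric] eq[symmetric] add_divide_distrib[symmetric]
    by (intro always_eventually allI divide_right_mono ln_1_plus_exp_bounds) simp
  have 1: "(\<lambda>n. 1 / N n) \<longlonglongrightarrow> 0" unfolding N_def by real_asymp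
  have 2: "(\<lambda>n. ln 2 / (N n)\<^sup>2) \<longlonglongrightarrow> 0" unfolding N_def by real_asymp
  show "(\<lambda>n. max (w - 1 / N n) 0) \<longlonglongrightarrow> max w 0"
    using tendsto_max[OF tendsto_diff[OF tendsto_const 1] tendsto_const] by simp
  from tendsto_add[OF this 2] show "(\<lambda>n. max (w - 1 / N n) 0 + ln 2 / (N n)\<^sup>2) \<longlonglongrightarrow> max w 0"
    by simp
qed

lemma tendsto_soft_step: "(\<lambda>n. soft_step n w) \<longlonglongrightarrow> (if w > 0 then 1 else 0)"
proof -
  consider "w > 0" | "w = 0" | "w < 0" by linarith
  then show ?thesis
  proof cases
    case 1
    then have "(\<lambda>n. 1 / (1 + exp (- ((real (Suc n))\<^sup>2 * w - real (Suc n))))) \<longlonglongrightarrow> 1" by real_asymp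
    then show ?thesis using 1 by (simp add: soft_step_def sigmoid_def)
  next
    case 2
    have "(\<lambda>n. 1 / (1 + exp (real (Suc n)))) \<longlonglongrightarrow> 0" by real_asymp
    then show ?thesis using 2 by (simp add: soft_step_def sigmoid_def add.commute)
  next
    case 3
    then have "(\<lambda>n. 1 / (1 + exp (- ((real (Suc n))\<^sup>2 * w - real (Suc n))))) \<longlonglongrightarrow> 0" by real_asymp
    then show ?thesis using 3 by (simp add: soft_step_def sigmoid_def)
  qed
qed

lemma soft_hinge_admissible:
  fixes l s u :: real and n :: nat
  assumes "l \<ge> 0" "\<bar>s\<bar> = 1"
  defines "\<phi> \<equiv> \<lambda>x. l * soft_hinge n (s * x - u)"
  shows "(\<phi> has_real_derivative l * s * soft_step n (s * x - u)) (at x)"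
    and "smooth \<phi>" "convex_on UNIV \<phi>" "l-lipschitz_on UNIV \<phi>"
proof -
  define g where "g x = soft_step n (s * x - u)" for x
  show d: "(\<phi> has_real_derivative l * s * soft_step n (s * x - u)) (at x)" for x
  proof -
    have "((\<lambda>x. soft_hinge n (s * x - u)) has_real_derivative soft_step n (s * x - u) * s) (at x)"
      by (rule DERIV_chain2[OF has_real_derivative_soft_hinge]) (auto intro!: derivative_eq_intros)
    from DERIV_cmult[OF this, of l] show ?thesis by (simp add: \<phi>_def mult.assoc mult.commute[of s])
  qed
  show "smooth \<phi>"
  proof (rule smoothI_deriv_poly)
    show "(\<phi> has_real_derivative poly [:0, l * s:] (g x)) (at x)" for x
      using d[of x] by (simp add: g_def mult.commute)
    \<comment> \<open>The logistic equation, rescaled by s and the square of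
      \<open>Suc n\<close>.\<close>
    show "(g has_real_derivative poly [:0, s * (real (Suc n))\<^sup>2, - (s * (real (Suc n))\<^sup>2):] (g x)) (at x)" for x
    proof -
      have "(g has_real_derivative (real (Suc n))\<^sup>2 * (g x * (1 - g x)) * s) (at x)"
        unfolding g_def by (rule DERIV_chain2[OF has_real_derivative_soft_step]) (auto intro!: derivative_eq_intros)
      then show ?thesis by (rule DERIV_cong) (simp add: algebra_simps)
    qed
  qed
  have s: "s = 1 \<or> s = -1" using assms by auto
  show "convex_on UNIV \<phi>"
  proof (rule convex_on_realI[OF _ d])
    fix x y :: real assume "x \<le> y"
    then show "l * s * soft_step n (s * x - u) \<le> l * s * soft_step n (s * y - u)"
      using s soft_step_mono[of "x - u" "y - u" n] soft_step_mono[of "- y - u" "- x - u" n] assms(1)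
      by (auto intro: mult_left_mono)
  qed auto
  show "l-lipschitz_on UNIV \<phi>"
  proof (rule lipschitz_onI)
    fix x y :: real
    have "norm (\<phi> x - \<phi> y) \<le> l * norm (x - y)"
    proof (rule field_differentiable_bound[of UNIV])
      show "(\<phi> has_field_derivative l * s * soft_step n (s * z - u)) (at z within UNIV)" for z
        using d by simp
      show "norm (l * s * soft_step n (s * z - u)) \<le> l" for z
        using assms sigmoid_pos[of "(real (Suc n))\<^sup>2 * (s * z - u) - real (Suc n)"]
          sigmoid_less_1[of "(real (Suc n))\<^sup>2 * (s * z - u) - real (Suc n)"]
        by (auto simp: abs_mult soft_step_def intro!: mult_left_le)
    qed auto
    then show "dist (\<phi> x) (\<phi> y) \<le> l * dist x y" by (simp add: dist_real_def)
  qed (use assms in auto)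
qed

section \<open>Exponential moments of hinges\<close>

text \<open>From ln t <= t - 1 at t = y / x. The entropy lower bounds below are this inequality at
  suitable y.\<close>

lemma mult_ln_ge_diff:
  fixes x y :: real
  assumes "0 < x" "0 < y"
  shows "x - y \<le> x * (ln x - ln y)"
proof -
  have "ln (y / x) \<le> y / x - 1" using assms by (intro ln_le_minus_one) auto
  then have "x * ln (y / x) \<le> x * (y / x - 1)" using assms by (intro mult_left_mono) auto
  then show ?thesis using assms by (simp add: ln_div algebra_simps)
qed

text \<open>Both values, Y with weight p and 1 with weight 1 - p, are compared with their mean Z;
  the linear errors cancel.\<close>

lemma two_point_entropy_nonneg:
  fixes p Y :: real
  assumes "0 < p" "p < 1" "0 < Y"
  defines "Z \<equiv> 1 - p + p * Y"
  shows "Z * ln Z \<le> p * Y * ln Y"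
proof -
  have Z: "Z > 0" unfolding Z_def using assms by (intro add_pos_pos) auto
  have "p * (Y - Z) \<le> p * (Y * (ln Y - ln Z))"
    using assms Z by (intro mult_left_mono mult_ln_ge_diff) auto
  moreover have "(1 - p) * (1 - Z) \<le> (1 - p) * (1 * (ln 1 - ln Z))"
    using assms Z by (intro mult_left_mono mult_ln_ge_diff) auto
  moreover have "p * (Y - Z) + (1 - p) * (1 - Z) = 0" by (simp add: Z_def algebra_simps)
  moreover have "p * (Y * (ln Y - ln Z)) + (1 - p) * (1 * (ln 1 - ln Z)) = p * Y * ln Y - Z * ln Z"
    by (simp add: Z_def algebra_simps)
  ultimately show ?thesis by linarith
qed

text \<open>The variational formula for the entropy, tested on the law with weight \<open>3p/2\<close> at the
  first point.\<close>

lemma two_point_entropy_ge: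
  fixes p Y :: real
  assumes "0 < p" "p \<le> 1 / 2" "0 < Y"
  defines "Z \<equiv> 1 - p + p * Y"
  shows "p * (Y / 3 - 1) \<le> p * Y * ln Y - Z * ln Z"
proof -
  \<comment> \<open>The test law has density 3/2 at the first point and q at the second, so that its
    total mass is 1.\<close>
  define q where "q = (1 - 3 / 2 * p) / (1 - p)"
  have Z: "Z > 0" unfolding Z_def using assms by (intro add_pos_pos) auto
  have q: "q > 0" unfolding q_def using assms by auto
  have "p * (Y - 3 / 2 * Z) \<le> p * (Y * (ln Y - ln (3 / 2 * Z)))"
    using assms Z by (intro mult_left_mono mult_ln_ge_diff) auto
  moreover have "(1 - p) * (1 - q * Z) \<le> (1 - p) * (1 * (ln 1 - ln (q * Z)))"
    using assms Z q by (intro mult_left_mono mult_ln_ge_diff) auto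
  moreover have "p * (Y - 3 / 2 * Z) + (1 - p) * (1 - q * Z) = 0"
  proof -
    have "(1 - p) * q = 1 - 3 / 2 * p" using assms by (simp add: q_def)
    moreover have "(1 - p) * (1 - q * Z) = 1 - p - ((1 - p) * q) * Z" by (simp add: algebra_simps)
    ultimately have eq: "(1 - p) * (1 - q * Z) = 1 - p - (1 - 3 / 2 * p) * Z" by (simp only:)
    show ?thesis unfolding eq by (simp add: Z_def algebra_simps)
  qed
  moreover have "p * (Y * (ln Y - ln (3 / 2 * Z))) + (1 - p) * (1 * (ln 1 - ln (q * Z))) =
      p * Y * ln Y - Z * ln Z - p * Y * ln (3 / 2) - (1 - p) * ln q"
  proof -
    have 1: "ln (3 / 2 * Z) = ln (3 / 2) + ln Z" using Z by (subst ln_mult) auto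
    have 2: "ln (q * Z) = ln q + ln Z" using Z q by (subst ln_mult) auto
    have 3: "Z * ln Z = (1 - p) * ln Z + p * Y * ln Z" by (simp add: Z_def algebra_simps)
    show ?thesis unfolding 1 2 3 by (simp add: algebra_simps)
  qed
  moreover have "p * Y * (1 / 3) \<le> p * Y * ln (3 / 2)"
  proof -
    have "3 / 2 - 1 \<le> 3 / 2 * (ln (3 / 2) - ln (1 :: real))" by (rule mult_ln_ge_diff) auto
    then show ?thesis using assms by (intro mult_left_mono) auto
  qed
  moreover have "- p \<le> (1 - p) * ln q"
  proof -
    have "q - 1 \<le> q * (ln q - ln 1)" using q by (intro mult_ln_ge_diff) auto
    then have "1 - 1 / q \<le> ln q" using q by (simp add: field_simps)
    then have "(1 - p) * (1 - 1 / q) \<le> (1 - p) * ln q" using assms by (intro mult_left_mono) auto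
    moreover have "- p \<le> (1 - p) * (1 - 1 / q)"
    proof -
      \<comment> \<open>Amounts to (1 - p)^2 <= 1 - 3p/2, that is, p <= 1/2.\<close>
      have "1 / q \<le> 1 + p / (1 - p)"
        using assms by (simp add: q_def field_simps)
      then have "(1 - p) * (1 / q) \<le> (1 - p) * (1 + p / (1 - p))"
        using assms by (intro mult_left_mono) auto
      also have "\<dots> = 1" using assms by (simp add: field_simps)
      finally show ?thesis by (simp add: algebra_simps)
    qed
    ultimately show ?thesis by linarith
  qed
  ultimately show ?thesis by (simp add: algebra_simps)
qed

section \<open>The inequality on hinges and conditional exponential moments\<close>

context cost_law
begin

text \<open>Hinges are limits of the admissible soft hinges, and the exponential moments supply the
  dominating functions. The indicator on the right is that of a strict inequality because the soft
  steps tend to 0 at the kink.\<close>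

lemma log_sobolev_hinge:
  fixes c s l u :: real
  assumes mom: "\<forall>s>0. integrable M (\<lambda>x. exp (s * \<bar>x\<bar>))" and c: "c > 0"
    and lsi: "\<forall>\<phi>. smooth \<phi> \<and> convex_on UNIV \<phi> \<and> (\<exists>L. L-lipschitz_on UNIV \<phi>) \<longrightarrow>
       Ent M (\<lambda>x. exp (\<phi> x)) \<le> enn2ereal (\<integral>\<^sup>+x. ennreal (H (c * deriv \<phi> x) * exp (\<phi> x)) \<partial>M)"
    and s: "\<bar>s\<bar> = 1" and l: "l > 0"
  defines "f \<equiv> \<lambda>x. max (s * x - u) 0"
  defines "Z \<equiv> \<integral>x. exp (l * f x) \<partial>M"
  shows "(\<integral>x. exp (l * f x) * (l * f x) \<partial>M) - Z * ln Z \<le>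
     H (c * l) * (\<integral>x. exp (l * f x) * indicator {x. s * x > u} x \<partial>M)"
proof -
  define \<phi> where "\<phi> n x = l * soft_hinge n (s * x - u)" for n x
  define d where "d n x = l * s * soft_step n (s * x - u)" for n x
  define K where "K = l * (\<bar>u\<bar> + 1)"
  have adm: "smooth (\<phi> n)" "convex_on UNIV (\<phi> n)" "l-lipschitz_on UNIV (\<phi> n)"
    and deriv: "(\<phi> n has_real_derivative d n x) (at x)" for n x
    unfolding \<phi>_def d_def using soft_hinge_admissible[of l s n u] l s by auto
  have [measurable]: "\<phi> n \<in> borel_measurable borel" for n
    using lipschitz_on_continuous_on[OF adm(3)] by (rule borel_measurable_continuous_onI)
  have [measurable]: "d n \<in> borel_measurable borel" for n
    unfolding d_def soft_step_def sigmoid_def by measurable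
  have [measurable]: "f \<in> borel_measurable borel" unfolding f_def by measurable
  have [measurable]: "{x. s * x > u} \<in> sets borel" by measurable
  have phi_nonneg: "0 \<le> \<phi> n x" for n x using l soft_hinge_nonneg by (simp add: \<phi>_def)
  have phi_le: "\<phi> n x \<le> K + l * \<bar>x\<bar>" for n x
  proof -
    have "\<bar>s * x - u\<bar> \<le> \<bar>x\<bar> + \<bar>u\<bar>" using s abs_triangle_ineq4[of "s * x" u] by (simp add: abs_mult)
    then have "soft_hinge n (s * x - u) \<le> \<bar>x\<bar> + \<bar>u\<bar> + 1" using soft_hinge_le[of n "s * x - u"] by linarith
    then have "\<phi> n x \<le> l * (\<bar>x\<bar> + \<bar>u\<bar> + 1)" unfolding \<phi>_def using l by (intro mult_left_mono) auto
    then show ?thesis by (simp add: K_def algebra_simps)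
  qed
  have d_le: "\<bar>d n x\<bar> \<le> l" for n x
    using l s sigmoid_pos[of "(real (Suc n))\<^sup>2 * (s * x - u) - real (Suc n)"]
      sigmoid_less_1[of "(real (Suc n))\<^sup>2 * (s * x - u) - real (Suc n)"]
    by (auto simp: d_def abs_mult soft_step_def intro!: mult_left_le)
  have int_dom: "integrable M (\<lambda>x. B * exp (K' + l' * \<bar>x\<bar>))" if "l' > 0" for B K' l' :: real
    using mom that by (auto simp: exp_add)
  have phi_lim: "(\<lambda>n. \<phi> n x) \<longlonglongrightarrow> l * f x" for x
    unfolding \<phi>_def f_def by (intro tendsto_mult tendsto_const tendsto_soft_hinge)
  have d_lim: "(\<lambda>n. d n x) \<longlonglongrightarrow> l * s * (if s * x > u then 1 else 0)" for x
    unfolding d_def using tendsto_mult[OF tendsto_const tendsto_soft_step[of "s * x - u"], of "l * s"] by simp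
  have b1: "\<bar>exp (\<phi> n x)\<bar> \<le> 1 * exp (K + l * \<bar>x\<bar>)" for n x
    using phi_le by simp
  have b2: "\<bar>exp (\<phi> n x) * \<phi> n x\<bar> \<le> 1 * exp (2 * K + 2 * l * \<bar>x\<bar>)" for n x
  proof -
    have "\<bar>exp (\<phi> n x) * \<phi> n x\<bar> = exp (\<phi> n x) * \<phi> n x" using phi_nonneg by (simp add: abs_mult)
    also have "\<dots> \<le> exp (\<phi> n x) * exp (\<phi> n x)"
      using exp_ge_add_one_self[of "\<phi> n x"] by (intro mult_left_mono) (auto simp del: exp_ge_add_one_self)
    also have "\<dots> \<le> 1 * exp (2 * K + 2 * l * \<bar>x\<bar>)"
      using phi_le[of n x] by (simp flip: exp_add)
    finally show ?thesis .
  qed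
  have b3: "\<bar>H (c * d n x) * exp (\<phi> n x)\<bar> \<le> H (c * l) * exp (K + l * \<bar>x\<bar>)" for n x
    unfolding abs_mult
    using c d_le[of n x] l b1[of n x] by (intro mult_mono) (auto simp: H_nonneg abs_mult intro!: H_mono mult_left_mono)
  have i1: "integrable M (\<lambda>x. exp (\<phi> n x))" for n
    by (rule Bochner_Integration.integrable_bound[OF int_dom[of l 1 K]]) (use l b1 in auto)
  have i2: "integrable M (\<lambda>x. exp (\<phi> n x) * \<phi> n x)" for n
    by (rule Bochner_Integration.integrable_bound[OF int_dom[of "2 * l" 1 "2 * K"]]) (use l b2 in auto)
  have i3: "integrable M (\<lambda>x. H (c * d n x) * exp (\<phi> n x))" for n
    by (rule Bochner_Integration.integrable_bound[OF int_dom[of l "H (c * l)" K]])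
       (use l b3 in \<open>auto intro!: AE_I2 intro: order_trans[OF _ abs_ge_self]\<close>)
  have ineq: "(\<integral>x. exp (\<phi> n x) * \<phi> n x \<partial>M) - (\<integral>x. exp (\<phi> n x) \<partial>M) * ln (\<integral>x. exp (\<phi> n x) \<partial>M)
      \<le> (\<integral>x. H (c * d n x) * exp (\<phi> n x) \<partial>M)" for n
  proof -
    have "deriv (\<phi> n) = d n" using DERIV_imp_deriv[OF deriv] by auto
    then have "Ent M (\<lambda>x. exp (\<phi> n x)) \<le> enn2ereal (\<integral>\<^sup>+x. ennreal (H (c * d n x) * exp (\<phi> n x)) \<partial>M)"
      using lsi adm[of n] by metis
    also have "(\<integral>\<^sup>+x. ennreal (H (c * d n x) * exp (\<phi> n x)) \<partial>M) = ennreal (\<integral>x. H (c * d n x) * exp (\<phi> n x) \<partial>M)"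
      by (rule nn_integral_eq_integral[OF i3]) (auto simp: H_nonneg)
    also have "enn2ereal \<dots> = ereal (\<integral>x. H (c * d n x) * exp (\<phi> n x) \<partial>M)"
      by (intro enn2ereal_ennreal integral_nonneg_AE) (auto simp: H_nonneg)
    finally show ?thesis using i2 by (simp add: Ent_def)
  qed
  have l1: "(\<lambda>n. \<integral>x. exp (\<phi> n x) \<partial>M) \<longlonglongrightarrow> Z"
    unfolding Z_def
    by (rule integral_dominated_convergence[OF _ _ int_dom[of l 1 K]])
       (use l b1 phi_lim in \<open>auto intro!: tendsto_exp\<close>)
  have l2: "(\<lambda>n. \<integral>x. exp (\<phi> n x) * \<phi> n x \<partial>M) \<longlonglongrightarrow> (\<integral>x. exp (l * f x) * (l * f x) \<partial>M)"
    by (rule integral_dominated_convergence[OF _ _ int_dom[of "2 * l" 1 "2 * K"]])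
       (use l b2 phi_lim in \<open>auto intro!: tendsto_exp tendsto_mult\<close>)
  have l3: "(\<lambda>n. \<integral>x. H (c * d n x) * exp (\<phi> n x) \<partial>M) \<longlonglongrightarrow>
      (\<integral>x. H (c * l) * (exp (l * f x) * indicator {x. s * x > u} x) \<partial>M)"
  proof (rule integral_dominated_convergence[OF _ _ int_dom[of l "H (c * l)" K]])
    show "AE x in M. (\<lambda>n. H (c * d n x) * exp (\<phi> n x)) \<longlonglongrightarrow> H (c * l) * (exp (l * f x) * indicator {x. s * x > u} x)"
    proof (rule AE_I2)
      fix x
      have "(\<lambda>n. H (c * d n x)) \<longlonglongrightarrow> H (c * (l * s * (if s * x > u then 1 else 0)))"
        by (rule continuous_on_tendsto_compose[OF H_continuous tendsto_mult[OF tendsto_const d_lim]]) auto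
      then have "(\<lambda>n. H (c * d n x) * exp (\<phi> n x)) \<longlonglongrightarrow>
          H (c * (l * s * (if s * x > u then 1 else 0))) * exp (l * f x)"
        by (intro tendsto_mult tendsto_exp phi_lim)
      moreover have "H (c * (l * s)) = H (c * l)"
        using s H_abs[of "c * (l * s)"] H_abs[of "c * l"] by (simp add: abs_mult)
      ultimately show "(\<lambda>n. H (c * d n x) * exp (\<phi> n x)) \<longlonglongrightarrow> H (c * l) * (exp (l * f x) * indicator {x. s * x > u} x)"
        by (auto simp: indicator_def split: if_splits)
    qed
  qed (use l b3 in auto)
  \<comment> \<open>Keeps the limit away from 0, where \<open>ln\<close> is not continuous.\<close>
  have "Z \<ge> 1"
  proof -
    have "(\<integral>x. 1 \<partial>M) \<le> (\<integral>x. exp (\<phi> n x) \<partial>M)" for n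
      using i1 phi_nonneg by (intro integral_mono) auto
    then have "1 \<le> (\<integral>x. exp (\<phi> n x) \<partial>M)" for n using prob_space by simp
    then show ?thesis by (intro LIMSEQ_le_const[OF l1]) auto
  qed
  then have "(\<lambda>n. (\<integral>x. exp (\<phi> n x) * \<phi> n x \<partial>M) - (\<integral>x. exp (\<phi> n x) \<partial>M) * ln (\<integral>x. exp (\<phi> n x) \<partial>M)) \<longlonglongrightarrow>
      (\<integral>x. exp (l * f x) * (l * f x) \<partial>M) - Z * ln Z"
    by (intro tendsto_diff tendsto_mult tendsto_ln l1 l2) auto
  from LIMSEQ_le[OF this l3] ineq show ?thesis by auto
qed

text \<open>V is the logarithm of the exponential moment conditioned on exceeding u. Bounding T
  below by Jensen reduces the entropy to that of a function equal to exp V on S and 1 elsewhere,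
  which gives the bound for small l. The Herbst step bounds T above and uses Jensen for the law
  weighted by exp (l w) on S. The last bound is Chernoff's.\<close>

lemma hinge_transform_bounds:
  fixes c s u :: real
  assumes mom: "\<forall>s>0. integrable M (\<lambda>x. exp (s * \<bar>x\<bar>))" and c: "c > 0"
    and lsi: "\<forall>\<phi>. smooth \<phi> \<and> convex_on UNIV \<phi> \<and> (\<exists>L. L-lipschitz_on UNIV \<phi>) \<longrightarrow>
       Ent M (\<lambda>x. exp (\<phi> x)) \<le> enn2ereal (\<integral>\<^sup>+x. ennreal (H (c * deriv \<phi> x) * exp (\<phi> x)) \<partial>M)"
    and s: "\<bar>s\<bar> = 1" and p0: "prob {x. s * x > u} > 0" and p_half: "prob {x. s * x > u} \<le> 1 / 2"
  defines "V \<equiv> \<lambda>l. ln ((\<integral>x. exp (l * (s * x - u)) * indicator {x. s * x > u} x \<partial>M) / prob {x. s * x > u})"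
  shows "l > 0 \<Longrightarrow> H (c * l) \<le> 1 / 6 \<Longrightarrow> V l \<le> ln 6"
    and "l > 0 \<Longrightarrow> V l \<le> 2 * V (l / 2) + H (c * l)"
    and "l > 0 \<Longrightarrow> r \<ge> 0 \<Longrightarrow> prob {x. s * x > u + r} \<le> prob {x. s * x > u} * exp (V l - l * r)"
proof -
  define S where "S = {x. s * x > u}"
  define p where "p = prob S"
  define w where "w x = s * x - u" for x
  define f where "f x = max (w x) 0" for x
  define N where "N l = (\<integral>x. exp (l * w x) * indicator S x \<partial>M)" for l
  have p: "0 < p" "p \<le> 1 / 2" using p0 p_half by (auto simp: p_def S_def)
  have [measurable]: "S \<in> sets borel" unfolding S_def by measurable
  have [measurable]: "w \<in> borel_measurable borel" unfolding w_def by measurable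
  have [measurable]: "f \<in> borel_measurable borel" unfolding f_def by measurable
  have f_S: "f x = w x" if "x \<in> S" for x using that by (simp add: S_def f_def w_def)
  have f_notS: "f x = 0" if "x \<notin> S" for x using that by (simp add: S_def f_def w_def)
  have f_nonneg: "0 \<le> f x" for x by (simp add: f_def)
  have f_le: "f x \<le> \<bar>x\<bar> + \<bar>u\<bar>" for x
    using s abs_triangle_ineq4[of "s * x" u] by (auto simp: f_def w_def abs_mult)
  have int_f: "integrable M (\<lambda>x. exp (l * f x))" if "l > 0" for l
  proof (rule integrable_exp_bounded[OF mom])
    show "\<bar>exp (l * f x)\<bar> \<le> exp (l * \<bar>u\<bar>) * exp (l * \<bar>x\<bar>)" for x
      using mult_left_mono[OF f_le, of l x] that by (simp add: algebra_simps flip: exp_add)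
  qed auto
  have int_ff: "integrable M (\<lambda>x. exp (l * f x) * (l * f x))" if "l > 0" for l
  proof (rule Bochner_Integration.integrable_bound[OF int_f[of "2 * l"]])
    show "AE x in M. norm (exp (l * f x) * (l * f x)) \<le> norm (exp (2 * l * f x))"
    proof (rule AE_I2)
      fix x
      have "exp (l * f x) * (l * f x) \<le> exp (l * f x) * exp (l * f x)"
        using exp_ge_add_one_self[of "l * f x"] by (intro mult_left_mono) (auto simp del: exp_ge_add_one_self)
      then show "norm (exp (l * f x) * (l * f x)) \<le> norm (exp (2 * l * f x))"
        using that f_nonneg[of x] by (simp add: abs_mult mult.assoc flip: exp_add)
    qed
  qed (use that in auto)
  have ind: "exp (l * w x) * indicator S x = exp (l * f x) * indicator S x" for l x
    using f_S[of x] by (auto simp: indicator_def)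
  have int_S: "integrable M (\<lambda>x. exp (l * w x) * indicator S x)" if "l > 0" for l
    unfolding ind using int_f[OF that] by (intro integrable_real_mult_indicator) auto
  have int_ind: "integrable M (indicator S :: real \<Rightarrow> real)" by (simp add: emeasure_eq_measure)
  have N_ge: "p \<le> N l" if "l > 0" for l
  proof -
    have "p = (\<integral>x. indicator S x \<partial>M)" by (simp add: p_def)
    also have "\<dots> \<le> N l"
      unfolding N_def
      by (rule integral_mono[OF int_ind int_S[OF that]]) (use that in \<open>auto simp: indicator_def S_def w_def\<close>)
    finally show ?thesis .
  qed
  have V_eq: "V l = ln (N l / p)" for l by (simp add: V_def N_def p_def S_def w_def)
  have expV: "N l = p * exp (V l)" if "l > 0" for l
    using N_ge[OF that] p by (simp add: V_eq)
  have Z_eq: "(\<integral>x. exp (l * f x) \<partial>M) = 1 - p + p * exp (V l)" if "l > 0" for l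
  proof -
    have "(\<integral>x. exp (l * f x) \<partial>M) = (\<integral>x. exp (l * w x) * indicator S x + (1 - indicator S x) \<partial>M)"
      by (intro Bochner_Integration.integral_cong) (auto simp: indicator_def f_S f_notS)
    also have "\<dots> = N l + (1 - p)"
      unfolding N_def using int_S[OF that] int_ind prob_space by (simp add: p_def)
    finally show ?thesis using expV[OF that] by simp
  qed
  define T where "T l = (\<integral>x. exp (l * f x) * (l * f x) \<partial>M)" for l
  have lsi_V: "T l - (1 - p + p * exp (V l)) * ln (1 - p + p * exp (V l)) \<le> H (c * l) * (p * exp (V l))"
    if l: "l > 0" for l
  proof -
    have "T l - (\<integral>x. exp (l * f x) \<partial>M) * ln (\<integral>x. exp (l * f x) \<partial>M) \<le>
        H (c * l) * (\<integral>x. exp (l * f x) * indicator S x \<partial>M)"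
      using log_sobolev_hinge[OF mom c lsi s l, of u] by (simp add: T_def f_def w_def S_def)
    moreover have "(\<integral>x. exp (l * f x) * indicator S x \<partial>M) = p * exp (V l)"
      using expV[OF l] by (simp add: N_def ind)
    ultimately show ?thesis by (simp add: Z_eq[OF l])
  qed
  have T_ge: "p * exp (V l) * V l \<le> T l" if l: "l > 0" for l
  proof -
    \<comment> \<open>On S the function x ln x is replaced by its tangent at exp V, the conditional
      mean of exp (l w).\<close>
    have pw: "(exp (l * w x) * indicator S x) * (1 + V l) - exp (V l) * indicator S x \<le> exp (l * f x) * (l * f x)" for x
    proof (cases "x \<in> S")
      case True
      have "exp (l * f x) - exp (V l) \<le> exp (l * f x) * (ln (exp (l * f x)) - ln (exp (V l)))"
        by (intro mult_ln_ge_diff) auto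
      then show ?thesis using True by (simp add: f_S algebra_simps)
    qed (simp add: f_notS)
    have "(\<integral>x. (exp (l * w x) * indicator S x) * (1 + V l) - exp (V l) * indicator S x \<partial>M) \<le> T l"
      unfolding T_def using int_S[OF l] int_ind int_ff[OF l] pw by (intro integral_mono) auto
    also have "(\<integral>x. (exp (l * w x) * indicator S x) * (1 + V l) - exp (V l) * indicator S x \<partial>M) =
        N l * (1 + V l) - exp (V l) * p"
      using int_S[OF l] int_ind by (simp add: N_def p_def)
    finally show ?thesis using expV[OF l] by (simp add: algebra_simps)
  qed
  show "V l \<le> ln 6" if l: "l > 0" and small: "H (c * l) \<le> 1 / 6" for l
  proof -
    \<comment> \<open>The right-hand side of the inequality is at most a sixth of p exp V, so it
      cannot balance the third on the left unless exp V <= 6.\<close>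
    have "p * (exp (V l) / 3 - 1) \<le> p * exp (V l) * ln (exp (V l)) -
        (1 - p + p * exp (V l)) * ln (1 - p + p * exp (V l))"
      by (rule two_point_entropy_ge) (use p in auto)
    also have "\<dots> \<le> T l - (1 - p + p * exp (V l)) * ln (1 - p + p * exp (V l))"
      using T_ge[OF l] by simp
    also have "\<dots> \<le> H (c * l) * (p * exp (V l))" by (rule lsi_V[OF l])
    also have "\<dots> \<le> 1 / 6 * (p * exp (V l))" using small p by (intro mult_right_mono) auto
    finally have "p * (exp (V l) / 3 - 1) \<le> p * (exp (V l) / 6)" by simp
    then have "exp (V l) / 3 - 1 \<le> exp (V l) / 6" using p by (simp only: mult_le_cancel_left_pos)
    then have "exp (V l) \<le> 6" by simp
    then show ?thesis by (subst ln_ge_iff) auto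
  qed
  show "V l \<le> 2 * V (l / 2) + H (c * l)" if l: "l > 0" for l
  proof -
    \<comment> \<open>An upper bound for the mean of l w / 2 under the weighted law. Jensen then
      gives V (l/2) >= V l - t, which is the claim.\<close>
    define t where "t = (V l + H (c * l)) / 2"
    have "(1 - p + p * exp (V l)) * ln (1 - p + p * exp (V l)) \<le> p * exp (V l) * ln (exp (V l))"
      by (rule two_point_entropy_nonneg) (use p in auto)
    then have T_le: "T l \<le> p * exp (V l) * (V l + H (c * l))"
      using lsi_V[OF l] by (simp add: algebra_simps)
    \<comment> \<open>The tangent at t to the exponential bounds exp (- l w / 2) below; integrated,
      this is Jensen's inequality.\<close>
    have pw: "exp (- t) * ((1 + t) * (exp (l * w x) * indicator S x) - 1 / 2 * (exp (l * f x) * (l * f x)))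
        \<le> exp (l / 2 * w x) * indicator S x" for x
    proof (cases "x \<in> S")
      case True
      have "1 + (t - l / 2 * w x) \<le> exp (t - l / 2 * w x)" by (rule exp_ge_add_one_self)
      then have "exp (- t) * exp (l * w x) * (1 + (t - l / 2 * w x)) \<le> exp (- t) * exp (l * w x) * exp (t - l / 2 * w x)"
        by (intro mult_left_mono) auto
      also have "\<dots> = exp (l / 2 * w x)" by (simp flip: exp_add)
      finally show ?thesis using True by (simp add: f_S algebra_simps)
    qed (simp add: f_notS)
    have "exp (- t) * (p * exp (V l)) \<le> exp (- t) * ((1 + t) * N l - 1 / 2 * T l)"
    proof (intro mult_left_mono)
      have "1 / 2 * T l \<le> p * exp (V l) * t" using T_le by (simp add: t_def)
      then show "p * exp (V l) \<le> (1 + t) * N l - 1 / 2 * T l"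
        using expV[OF l] by (simp add: algebra_simps)
    qed auto
    also have "\<dots> = (\<integral>x. exp (- t) * ((1 + t) * (exp (l * w x) * indicator S x) - 1 / 2 * (exp (l * f x) * (l * f x))) \<partial>M)"
      using int_S[OF l] int_ff[OF l] by (simp add: N_def T_def)
    also have "\<dots> \<le> N (l / 2)"
      unfolding N_def using int_S[OF l] int_ff[OF l] int_S[of "l / 2"] l pw by (intro integral_mono) auto
    also have "\<dots> = p * exp (V (l / 2))" using expV[of "l / 2"] l by simp
    finally have "exp (V l - t) \<le> exp (V (l / 2))" using p by (simp add: exp_diff exp_minus field_simps)
    then show ?thesis by (simp add: t_def field_simps)
  qed
  show "prob {x. s * x > u + r} \<le> prob {x. s * x > u} * exp (V l - l * r)" if l: "l > 0" and r: "r \<ge> 0"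
  proof -
    have [measurable]: "{x. s * x > u + r} \<in> sets borel" by measurable
    have "exp (l * r) * prob {x. s * x > u + r} = (\<integral>x. exp (l * r) * indicator {x. s * x > u + r} x \<partial>M)"
      by simp
    also have "\<dots> \<le> N l"
      unfolding N_def
    proof (rule integral_mono[OF _ int_S[OF l]])
      show "integrable M (\<lambda>x. exp (l * r) * indicator {x. s * x > u + r} x)" by (simp add: emeasure_eq_measure)
    qed (use l r in \<open>auto simp: indicator_def S_def w_def\<close>)
    finally have "exp (l * r) * prob {x. s * x > u + r} \<le> p * exp (V l)" using expV[OF l] by simp
    then show ?thesis by (simp add: p_def S_def exp_diff field_simps)
  qed
qed

end

section \<open>Tail bounds and the transport map\<close>

context cost_law
begin

text \<open>A times the sum of the geometric series with ratio 2^(1 - \<alpha>): the j-th halving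
  costs 2^j H (c l / 2^j), which the growth condition bounds by A 2^(j (1 - \<alpha>)) H (c
  l).\<close>

definition growth_const :: real where
  "growth_const = A / (1 - 2 powr (1 - \<alpha>))"

lemma growth_ratio: "0 < 2 powr (1 - \<alpha>)" "2 powr (1 - \<alpha>) < (1 :: real)"
  using powr_less_mono[of "1 - \<alpha>" 0 "2::real"] alpha_gt by auto

lemma growth_const_ge_1: "1 \<le> growth_const"
proof -
  have "1 - 2 powr (1 - \<alpha>) \<le> A" using growth_ratio(1) A_ge by linarith
  then show ?thesis using growth_ratio(2) by (simp add: growth_const_def le_divide_eq)
qed

lemma doubling_iterate:
  fixes V :: "real \<Rightarrow> real"
  assumes dbl: "\<And>l. l > 0 \<Longrightarrow> V l \<le> 2 * V (l / 2) + H (c * l)" and l: "l > 0"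
  shows "V l \<le> 2 ^ n * V (l / 2 ^ n) + growth_const * H (c * l)"
proof -
  define q where "q = (2 :: real) powr (1 - \<alpha>)"
  have q: "0 < q" "q < 1" using growth_ratio by (auto simp: q_def)
  have "V l \<le> 2 ^ n * V (l / 2 ^ n) + (\<Sum>j<n. 2 ^ j * H (c * (l / 2 ^ j)))"
  proof (induction n)
    case (Suc n)
    have "2 ^ n * V (l / 2 ^ n) \<le> 2 ^ n * (2 * V (l / 2 ^ n / 2) + H (c * (l / 2 ^ n)))"
      using dbl[of "l / 2 ^ n"] l by (intro mult_left_mono) auto
    then show ?case using Suc by (simp add: algebra_simps)
  qed simp
  also have "(\<Sum>j<n. 2 ^ j * H (c * (l / 2 ^ j))) \<le> (\<Sum>j<n. A * H (c * l) * q ^ j)"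
  proof (rule sum_mono)
    fix j
    have "H (1 / 2 ^ j * (c * l)) \<le> A * (1 / 2 ^ j) powr \<alpha> * H (c * l)"
      by (rule H_growth) auto
    then have "2 ^ j * H (c * (l / 2 ^ j)) \<le> 2 ^ j * (A * (1 / 2 ^ j) powr \<alpha> * H (c * l))"
      by (intro mult_left_mono) (auto simp: mult.commute)
    also have "\<dots> = A * H (c * l) * (2 ^ j * (1 / 2 ^ j) powr \<alpha>)" by simp
    also have "2 ^ j * (1 / 2 ^ j) powr \<alpha> = q ^ j"
    proof -
      have "(2::real) ^ j = 2 powr real j" by (simp add: powr_realpow)
      moreover have "(1 / 2 ^ j) powr \<alpha> = (2::real) powr (- real j * \<alpha>)"
        by (simp add: powr_powr powr_minus_divide powr_divide flip: powr_realpow)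
      moreover have "q ^ j = 2 powr ((1 - \<alpha>) * real j)"
        unfolding q_def by (simp add: powr_powr flip: powr_realpow)
      ultimately show ?thesis by (simp add: algebra_simps flip: powr_add)
    qed
    finally show "2 ^ j * H (c * (l / 2 ^ j)) \<le> A * H (c * l) * q ^ j" .
  qed
  also have "\<dots> = A * H (c * l) * (\<Sum>j<n. q ^ j)" by (simp add: sum_distrib_left)
  also have "\<dots> \<le> A * H (c * l) * (1 / (1 - q))"
  proof (intro mult_left_mono)
    have "(\<Sum>j<n. q ^ j) = (1 - q ^ n) / (1 - q)" using q by (simp add: sum_gp_strict)
    then show "(\<Sum>j<n. q ^ j) \<le> 1 / (1 - q)" using q by (simp add: divide_right_mono)
  qed (use A_ge H_nonneg in auto)
  also have "\<dots> = growth_const * H (c * l)" by (simp add: growth_const_def q_def)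
  finally show ?thesis by simp
qed

text \<open>Halving stops at the first n with l / 2^n <= l1. Minimality gives 2^n <= 2 l / l1, so
  the initial bound K is amplified only linearly in l.\<close>

lemma doubling_bound:
  fixes V :: "real \<Rightarrow> real"
  assumes dbl: "\<And>l. l > 0 \<Longrightarrow> V l \<le> 2 * V (l / 2) + H (c * l)"
    and small: "\<And>l. 0 < l \<Longrightarrow> l \<le> l1 \<Longrightarrow> V l \<le> K" and l1: "l1 > 0" and K: "K \<ge> 0" and l: "l > 0"
  shows "V l \<le> K + 2 * K / l1 * l + growth_const * H (c * l)"
proof (cases "l \<le> l1")
  case True
  have "V l \<le> K" using small[OF l True] .
  moreover have "0 \<le> 2 * K / l1 * l" "0 \<le> growth_const * H (c * l)"
    using K l1 l growth_const_ge_1 H_nonneg by auto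
  ultimately show ?thesis by linarith
next
  case False
  have ex: "\<exists>n. l \<le> l1 * 2 ^ n"
  proof -
    obtain n where "l / l1 < 2 ^ n" using real_arch_pow[of 2 "l / l1"] by auto
    then show ?thesis using l1 by (auto simp: field_simps intro!: exI[of _ n])
  qed
  define n where "n = (LEAST n. l \<le> l1 * 2 ^ n)"
  have n: "l \<le> l1 * 2 ^ n" unfolding n_def using ex by (rule LeastI_ex)
  then obtain m where m: "n = Suc m" using False by (cases n) auto
  have "\<not> l \<le> l1 * 2 ^ m" using not_less_Least[of m "\<lambda>n. l \<le> l1 * 2 ^ n"] m by (simp add: n_def)
  then have "2 ^ n \<le> 2 / l1 * l" using l1 m by (simp add: field_simps)
  then have "2 ^ n * K \<le> 2 / l1 * l * K" using K by (intro mult_right_mono)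
  moreover have "2 ^ n * V (l / 2 ^ n) \<le> 2 ^ n * K"
    using small[of "l / 2 ^ n"] n l by (intro mult_left_mono) (auto simp: field_simps)
  moreover have "2 / l1 * l * K = 2 * K / l1 * l" by simp
  ultimately show ?thesis
    using doubling_iterate[OF dbl l, of n] K by linarith
qed

text \<open>In Chernoff's bound the offset K cancels the linear term of V, and the factor a turns
  the H-term into its Legendre dual after the substitution y = c l. Of ln 12, the factor 6 pays for
  the bound on V near 0, and 2 gives the extra 1/2 in the conclusion.\<close>

lemma tail_bound:
  fixes c :: real
  assumes mom: "\<forall>s>0. integrable M (\<lambda>x. exp (s * \<bar>x\<bar>))" and c: "c > 0"
    and lsi: "\<forall>\<phi>. smooth \<phi> \<and> convex_on UNIV \<phi> \<and> (\<exists>L. L-lipschitz_on UNIV \<phi>) \<longrightarrow>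
       Ent M (\<lambda>x. exp (\<phi> x)) \<le> enn2ereal (\<integral>\<^sup>+x. ennreal (H (c * deriv \<phi> x) * exp (\<phi> x)) \<partial>M)"
  shows "\<exists>K\<ge>0. \<exists>a>0. \<forall>s u h. \<bar>s\<bar> = 1 \<longrightarrow> prob {x. s * x > u} \<le> 1 / 2 \<longrightarrow> h \<ge> 0 \<longrightarrow>
     prob {x. s * x > u + (K + a * \<theta>_inv (h + ln 12))} \<le> prob {x. s * x > u} * exp (- h) / 2"
proof -
  \<comment> \<open>Keeps c l in the quadratic range with (c l)^2 / 4 <= 4/25 < 1/6.\<close>
  define l1 where "l1 = min (2 * t0) (4 / 5) / c"
  have l1: "l1 > 0" using c t0_pos by (simp add: l1_def)
  have l1_small: "H (c * l) \<le> 1 / 6" if "0 < l" "l \<le> l1" for l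
  proof -
    have cl: "0 \<le> c * l" "c * l \<le> min (2 * t0) (4 / 5)"
      using that c by (auto simp: l1_def field_simps)
    then have "H (c * l) = (c * l)\<^sup>2 / 4" by (intro H_quad) auto
    also have "\<dots> \<le> (4 / 5)\<^sup>2 / 4" using cl by (intro divide_right_mono power_mono) auto
    finally show ?thesis by (simp add: power2_eq_square)
  qed
  define K where "K = 2 * ln 6 / l1"
  define a where "a = c * growth_const"
  have K: "K \<ge> 0" and a: "a > 0" using l1 c growth_const_ge_1 by (auto simp: K_def a_def)
  have "prob {x. s * x > u + (K + a * \<theta>_inv (h + ln 12))} \<le> prob {x. s * x > u} * exp (- h) / 2"
    if s: "\<bar>s\<bar> = 1" and half: "prob {x. s * x > u} \<le> 1 / 2" and h: "h \<ge> 0" for s u h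
  proof -
    define \<rho> where "\<rho> = \<theta>_inv (h + ln 12)"
    have \<rho>: "\<rho> \<ge> 0" "\<theta> \<rho> = h + ln 12"
      using legendre_inv[of "h + ln 12"] h by (auto simp: \<rho>_def)
    define r where "r = K + a * \<rho>"
    have r: "r \<ge> 0" using K a \<rho> by (simp add: r_def)
    define p where "p = prob {x. s * x > u}"
    define P where "P = prob {x. s * x > u + r}"
    have [measurable]: "{x. s * x > v} \<in> sets borel" for v by measurable
    have "P \<le> p" unfolding P_def p_def using r by (intro finite_measure_mono) auto
    have "P \<ge> 0" by (simp add: P_def)
    show ?thesis
    proof (cases "P = 0")
      case True
      then show ?thesis by (simp add: P_def r_def \<rho>_def)
    next
      case False
      then have P: "P > 0" using \<open>P \<ge> 0\<close> by simp
      then have p: "p > 0" using \<open>P \<le> p\<close> by simp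
      define V where "V l = ln ((\<integral>x. exp (l * (s * x - u)) * indicator {x. s * x > u} x \<partial>M) / prob {x. s * x > u})" for l
      note bounds = hinge_transform_bounds[OF mom c lsi s p[unfolded p_def] half, folded V_def]
      have V_le: "V l \<le> ln 6 + 2 * ln 6 / l1 * l + growth_const * H (c * l)" if "l > 0" for l
        by (rule doubling_bound[OF bounds(2) _ l1 _ that]) (auto intro: bounds(1) l1_small)
      have "\<rho> * y - H y \<le> ln (6 * p / P)" for y
      \<comment> \<open>Outside this case the left side is at most 0 and P <= p suffices. Inside, y
        > 0 yields an admissible l, and the sign permits replacing \<open>growth_const\<close> by
        1.\<close>
      proof (cases "0 \<le> \<rho> * y - H y \<and> y > 0")
        case False
        have "\<rho> * y \<le> 0" if "y \<le> 0" using that \<rho> by (simp add: mult_nonneg_nonpos)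
        then have "\<rho> * y - H y \<le> 0" using False H_nonneg[of y] by (cases "y > 0") auto
        also have "0 \<le> ln (6 * p / P)"
          using P \<open>P \<le> p\<close> by (intro ln_ge_zero) (auto simp: field_simps)
        finally show ?thesis .
      next
        case True
        define l where "l = y / c"
        have l: "l > 0" "c * l = y" using True c by (auto simp: l_def)
        have "P \<le> p * exp (V l - l * r)" unfolding P_def p_def by (rule bounds(3)[OF l(1) r])
        also have "V l - l * r \<le> ln 6 - growth_const * (\<rho> * y - H y)"
        proof -
          have "l * r = 2 * ln 6 / l1 * l + growth_const * (\<rho> * y)"
            by (simp add: r_def K_def a_def l(2)[symmetric] algebra_simps)
          moreover have "growth_const * (\<rho> * y - H y) = growth_const * (\<rho> * y) - growth_const * H y"
            by (rule right_diff_distrib)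
          ultimately show ?thesis using V_le[OF l(1)] unfolding l(2) by linarith
        qed
        also have "\<dots> \<le> ln 6 - 1 * (\<rho> * y - H y)"
          using True growth_const_ge_1 by (intro diff_left_mono mult_right_mono) auto
        finally have "P \<le> p * exp (ln 6 - (\<rho> * y - H y))" using p by simp
        then have "exp (\<rho> * y - H y) \<le> 6 * p / P" using P by (simp add: exp_diff exp_add field_simps)
        then show ?thesis using P p by (subst ln_ge_iff) auto
      qed
      then have "\<theta> \<rho> \<le> ln (6 * p / P)" by (rule legendre_leI)
      then have "exp (h + ln 12) \<le> 6 * p / P" using \<rho> P p by (subst (asm) ln_ge_iff) auto
      then have "P \<le> p * exp (- h) / 2" using P by (simp add: exp_add exp_minus field_simps)
      then show ?thesis by (simp add: P_def p_def r_def \<rho>_def)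
    qed
  qed
  then show ?thesis using K a by blast
qed

text \<open>The tail bound at u = U x controls increments to the right of 0, and its reflection
  those to the left. An interval containing 0 in its interior is split there, which costs the factor
  2. The constants K and ln 12 are then absorbed into b.\<close>

lemma quantile_increment:
  fixes c :: real
  assumes mom: "\<forall>s>0. integrable M (\<lambda>x. exp (s * \<bar>x\<bar>))" and c: "c > 0"
    and lsi: "\<forall>\<phi>. smooth \<phi> \<and> convex_on UNIV \<phi> \<and> (\<exists>L. L-lipschitz_on UNIV \<phi>) \<longrightarrow>
       Ent M (\<lambda>x. exp (\<phi> x)) \<le> enn2ereal (\<integral>\<^sup>+x. ennreal (H (c * deriv \<phi> x) * exp (\<phi> x)) \<partial>M)"
  shows "\<exists>b>0. \<forall>x. \<forall>h>0. U (x + h) - U x \<le> \<theta>_inv (t0\<^sup>2 + h) / b"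
proof -
  obtain K a where K: "K \<ge> 0" and a: "a > 0"
    and tail: "\<forall>s u h. \<bar>s\<bar> = 1 \<longrightarrow> prob {x. s * x > u} \<le> 1 / 2 \<longrightarrow> h \<ge> 0 \<longrightarrow>
     prob {x. s * x > u + (K + a * \<theta>_inv (h + ln 12))} \<le> prob {x. s * x > u} * exp (- h) / 2"
    using tail_bound[OF mom c lsi] by blast
  define B where "B h = K + a * \<theta>_inv (h + ln 12)" for h
  have B_mono: "B h \<le> B h'" if "0 \<le> h" "h \<le> h'" for h h'
    unfolding B_def using a that by (intro add_left_mono mult_left_mono legendre_inv_mono) auto
  have B_nonneg: "0 \<le> B h" if "0 \<le> h" for h
    unfolding B_def using a K that by (intro add_nonneg_nonneg mult_nonneg_nonneg legendre_inv_nonneg) auto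
  have right: "U (x + h) \<le> U x + B h" if x: "x \<ge> 0" and h: "h \<ge> 0" for x h
  proof -
    have compl: "prob {y. 1 * y > v} = 1 - prob {..v}" for v
      using prob_compl[of "{..v}"] by (simp add: Compl_eq_Diff_UNIV[symmetric] greaterThan_def[symmetric])
    have "F_tau x \<le> prob {..U x}" by (simp flip: U_map_le_iff)
    then have p: "prob {y. 1 * y > U x} \<le> exp (- x) / 2" using x unfolding compl by (simp add: F_tau_def)
    then have half: "prob {y. 1 * y > U x} \<le> 1 / 2" using x by (auto intro: order_trans)
    have "prob {y. 1 * y > U x + B h} \<le> prob {y. 1 * y > U x} * exp (- h) / 2"
      unfolding B_def using tail[rule_format, of 1, OF _ half h] by simp
    also have "\<dots> \<le> exp (- x) / 2 * exp (- h) / 2"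
      using p by (intro divide_right_mono mult_right_mono) auto
    also have "\<dots> \<le> exp (- (x + h)) / 2" by (simp add: exp_add exp_diff exp_minus field_simps)
    finally have "F_tau (x + h) \<le> prob {..U x + B h}" using x h unfolding compl by (simp add: F_tau_def)
    then show ?thesis by (simp add: U_map_le_iff)
  qed
  have left: "U y - B h \<le> U (y - h)" if y: "y \<le> 0" and h: "h \<ge> 0" for y h
  proof (rule ccontr)
    assume neg: "\<not> U y - B h \<le> U (y - h)"
    have F_nonpos: "F_tau z = exp z / 2" if "z \<le> 0" for z
      using that by (cases "z = 0") (auto simp: F_tau_def)
    have refl: "{x. - 1 * x > - v} = {..<v}" for v :: real by auto
    \<comment> \<open>M may have an atom at U y, so the bound is taken on the open half-line, as a
      left limit of the distribution function.\<close>
    have "prob {..<U y} \<le> F_tau y"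
    proof (rule tendsto_upperbound[OF cdf_at_left])
      show "eventually (\<lambda>z. cdf M z \<le> F_tau y) (at_left (U y))"
        using U_map_le_iff[of y] by (auto simp: eventually_at_filter cdf_def intro!: always_eventually)
          (metis linorder_not_le order_less_imp_le)
    qed simp
    then have p: "prob {x. - 1 * x > - U y} \<le> exp y / 2" unfolding refl using F_nonpos[OF y] by simp
    then have half: "prob {x. - 1 * x > - U y} \<le> 1 / 2" using y by (auto intro: order_trans)
    have "exp (y - h) / 2 = F_tau (y - h)" using F_nonpos[of "y - h"] y h by simp
    also have "\<dots> \<le> prob {..U (y - h)}" by (simp flip: U_map_le_iff)
    also have "\<dots> \<le> prob {..<U y - B h}" using neg by (intro finite_measure_mono) auto
    also have "\<dots> = prob {x. - 1 * x > - U y + B h}"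
      using refl[of "U y - B h"] by simp
    also have "\<dots> \<le> prob {x. - 1 * x > - U y} * exp (- h) / 2"
      unfolding B_def using tail[rule_format, of "- 1", OF _ half h] by simp
    also have "\<dots> \<le> exp y / 2 * exp (- h) / 2"
      using p by (intro divide_right_mono mult_right_mono) auto
    \<comment> \<open>The extra factor 1/2 of \<open>tail_bound\<close> makes the contradiction
      strict.\<close>
    finally show False by (simp add: exp_diff exp_minus field_simps)
  qed
  have U_le: "U (x + h) - U x \<le> 2 * B h" if h: "h > 0" for x h
  proof -
    consider "x \<ge> 0" | "x + h \<le> 0" | "x < 0" "x + h > 0" by linarith
    then show ?thesis
    proof cases
      case 1
      then show ?thesis using right[of x h] B_nonneg[of h] h by simp
    next
      case 2
      then show ?thesis using left[of "x + h" h] B_nonneg[of h] h by simp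
    next
      case 3
      have "U (0 + (x + h)) \<le> U 0 + B (x + h)" using 3 by (intro right) auto
      moreover have "U 0 - B (- x) \<le> U (0 - (- x))" using 3 by (intro left) auto
      moreover have "B (x + h) \<le> B h" "B (- x) \<le> B h" using 3 by (auto intro!: B_mono)
      ultimately show ?thesis by simp
    qed
  qed
  \<comment> \<open>\<eta> gives h + ln 12 <= \<eta> (t0^2 + h), after which
    \<open>legendre_inv_scale\<close> extracts it. The constant K is compared with
    \<open>\<theta>_inv (t0\<^sup>2)\<close>, the least value of the inverse on the relevant
    range.\<close>
  define \<eta> where "\<eta> = max 1 (ln 12 / t0\<^sup>2)"
  define b where "b = 1 / (2 * (K / \<theta>_inv (t0\<^sup>2) + a * \<eta>))"
  have \<theta>0: "\<theta>_inv (t0\<^sup>2) > 0" using t0_pos by (intro legendre_inv_pos) auto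
  have \<eta>: "\<eta> \<ge> 1" by (simp add: \<eta>_def)
  have pos: "K / \<theta>_inv (t0\<^sup>2) + a * \<eta> > 0"
    using K a \<theta>0 \<eta> by (intro add_nonneg_pos) auto
  have "2 * B h \<le> \<theta>_inv (t0\<^sup>2 + h) / b" if h: "h > 0" for h
  proof -
    have "K = K / \<theta>_inv (t0\<^sup>2) * \<theta>_inv (t0\<^sup>2)" using \<theta>0 by simp
    also have "\<dots> \<le> K / \<theta>_inv (t0\<^sup>2) * \<theta>_inv (t0\<^sup>2 + h)"
      using K \<theta>0 h by (intro mult_left_mono legendre_inv_mono) auto
    finally have 1: "K \<le> K / \<theta>_inv (t0\<^sup>2) * \<theta>_inv (t0\<^sup>2 + h)" .
    have "\<theta>_inv (h + ln 12) \<le> \<theta>_inv (\<eta> * (t0\<^sup>2 + h))"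
    proof (rule legendre_inv_mono)
      have "ln 12 = ln 12 / t0\<^sup>2 * t0\<^sup>2" using t0_pos by simp
      also have "\<dots> \<le> \<eta> * t0\<^sup>2" by (intro mult_right_mono) (auto simp: \<eta>_def)
      finally have "ln 12 \<le> \<eta> * t0\<^sup>2" .
      moreover have "1 * h \<le> \<eta> * h" using \<eta> h by (intro mult_right_mono) auto
      ultimately show "h + ln 12 \<le> \<eta> * (t0\<^sup>2 + h)" by (simp add: algebra_simps)
    qed (use h in auto)
    also have "\<dots> \<le> \<eta> * \<theta>_inv (t0\<^sup>2 + h)" using \<eta> h by (intro legendre_inv_scale) auto
    finally have 2: "\<theta>_inv (h + ln 12) \<le> \<eta> * \<theta>_inv (t0\<^sup>2 + h)" .
    have eq: "\<theta>_inv (t0\<^sup>2 + h) / b =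
        2 * (K / \<theta>_inv (t0\<^sup>2) * \<theta>_inv (t0\<^sup>2 + h) + a * (\<eta> * \<theta>_inv (t0\<^sup>2 + h)))"
      by (simp add: b_def algebra_simps)
    show ?thesis unfolding B_def eq using a by (intro mult_left_mono add_mono 1 2) auto
  qed
  then have "\<forall>x. \<forall>h>0. U (x + h) - U x \<le> \<theta>_inv (t0\<^sup>2 + h) / b" using U_le order_trans by blast
  moreover have "b > 0" using pos by (simp add: b_def)
  ultimately show ?thesis by blast
qed

end

theorem theorem1p1:
  fixes H :: "real \<Rightarrow> real" and t0 A \<alpha> :: real and \<mu> :: "real measure"
  assumes H_nonneg: "\<forall>x. 0 \<le> H x"
    and H_sym: "\<forall>x. H (- x) = H x"
    and H_convex: "convex_on UNIV H"
    and t0_pos: "t0 > 0"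
    and H_quad: "\<forall>x\<in>{-2*t0..2*t0}. H x = x\<^sup>2 / 4"
    and Hstar_superlin: "filterlim (\<lambda>x. legendre H x / x) at_top at_top"
    and A_ge: "A \<ge> 1"
    and alpha: "1 < \<alpha>" "\<alpha> \<le> 2"
    and H_growth: "\<forall>x. \<forall>s\<in>{0..1}. H (s * x) \<le> A * s powr \<alpha> * H x"
    and prob: "prob_space \<mu>"
    and borel: "sets \<mu> = sets borel"
  shows "((\<forall>s>0. integrable \<mu> (\<lambda>x. exp (s * \<bar>x\<bar>))) \<and>
          (\<exists>c>0. \<forall>\<phi> :: real \<Rightarrow> real. smooth \<phi> \<and> convex_on UNIV \<phi> \<and> (\<exists>L. L-lipschitz_on UNIV \<phi>) \<longrightarrow>
             Ent \<mu> (\<lambda>x. exp (\<phi> x)) \<le>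
               enn2ereal (\<integral>\<^sup>+ x. ennreal (H (c * deriv \<phi> x) * exp (\<phi> x)) \<partial>\<mu>)))
     \<longleftrightarrow>
         (\<exists>b>0. \<forall>h>0. Delta \<mu> h \<le> ereal (the_inv_into {0..} (legendre H) (t0\<^sup>2 + h) / b))"
proof -
  interpret prob_space \<mu> by fact
  interpret cost_law H t0 A \<alpha> \<mu>
    by unfold_locales (use assms in \<open>auto simp: abs_le_iff\<close>)
  have Delta_le: "Delta \<mu> h \<le> ereal v \<longleftrightarrow> (\<forall>x. U_map \<mu> (x + h) - U_map \<mu> x \<le> v)" for h v
    by (simp add: Delta_def SUP_le_iff)
  show ?thesis
  proof (intro iffI conjI)
    assume "(\<forall>s>0. integrable \<mu> (\<lambda>x. exp (s * \<bar>x\<bar>))) \<and>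
          (\<exists>c>0. \<forall>\<phi> :: real \<Rightarrow> real. smooth \<phi> \<and> convex_on UNIV \<phi> \<and> (\<exists>L. L-lipschitz_on UNIV \<phi>) \<longrightarrow>
             Ent \<mu> (\<lambda>x. exp (\<phi> x)) \<le>
               enn2ereal (\<integral>\<^sup>+ x. ennreal (H (c * deriv \<phi> x) * exp (\<phi> x)) \<partial>\<mu>))"
    then show "\<exists>b>0. \<forall>h>0. Delta \<mu> h \<le> ereal (the_inv_into {0..} (legendre H) (t0\<^sup>2 + h) / b)"
    proof (elim conjE exE)
      fix c assume "\<forall>s>0. integrable \<mu> (\<lambda>x. exp (s * \<bar>x\<bar>))" "c > 0"
        "\<forall>\<phi> :: real \<Rightarrow> real. smooth \<phi> \<and> convex_on UNIV \<phi> \<and> (\<exists>L. L-lipschitz_on UNIV \<phi>) \<longrightarrow>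
             Ent \<mu> (\<lambda>x. exp (\<phi> x)) \<le>
               enn2ereal (\<integral>\<^sup>+ x. ennreal (H (c * deriv \<phi> x) * exp (\<phi> x)) \<partial>\<mu>)"
      from quantile_increment[OF this] show ?thesis unfolding Delta_le by blast
    qed
  next
    assume "\<exists>b>0. \<forall>h>0. Delta \<mu> h \<le> ereal (the_inv_into {0..} (legendre H) (t0\<^sup>2 + h) / b)"
    then obtain b where b: "b > 0"
      and D: "\<forall>x. \<forall>h>0. U_map \<mu> (x + h) - U_map \<mu> x \<le> the_inv_into {0..} (legendre H) (t0\<^sup>2 + h) / b"
      unfolding Delta_le by blast
    show "\<forall>s>0. integrable \<mu> (\<lambda>x. exp (s * \<bar>x\<bar>))" by (rule exponential_moments[OF b D])
    obtain c where c: "c > 0" and lsi: "\<forall>\<phi> d L. convex_on UNIV \<phi> \<longrightarrow> L-lipschitz_on UNIV \<phi> \<longrightarrow>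
       (\<forall>x. (\<phi> has_real_derivative d x) (at x)) \<longrightarrow> d \<in> borel_measurable borel \<longrightarrow>
       Ent \<mu> (\<lambda>x. exp (\<phi> x)) \<le> enn2ereal (\<integral>\<^sup>+x. ennreal (H (c * d x) * exp (\<phi> x)) \<partial>\<mu>)"
      using modified_log_sobolev[OF b D] by (elim exE conjE) (rule that)
    have "Ent \<mu> (\<lambda>x. exp (\<phi> x)) \<le> enn2ereal (\<integral>\<^sup>+ x. ennreal (H (c * deriv \<phi> x) * exp (\<phi> x)) \<partial>\<mu>)"
      if "smooth \<phi>" "convex_on UNIV \<phi>" "L-lipschitz_on UNIV \<phi>" for \<phi> L
    proof (rule lsi[rule_format, OF that(2,3)])
      have diff: "((deriv ^^ k) \<phi>) differentiable (at x)" for k x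
        using that(1) by (simp add: smooth_def)
      show "(\<phi> has_real_derivative deriv \<phi> x) (at x)" for x
        using diff[of 0 x] DERIV_deriv_iff_real_differentiable by auto
      \<comment> \<open>The second derivative exists, so the first is continuous and hence
        Borel.\<close>
      have "continuous_on UNIV (deriv \<phi>)"
        using diff[of 1] differentiable_imp_continuous_within
        by (auto simp: continuous_on_eq_continuous_within)
      then show "deriv \<phi> \<in> borel_measurable borel" by (rule borel_measurable_continuous_onI)
    qed
    then show "\<exists>c>0. \<forall>\<phi> :: real \<Rightarrow> real. smooth \<phi> \<and> convex_on UNIV \<phi> \<and> (\<exists>L. L-lipschitz_on UNIV \<phi>) \<longrightarrow>
             Ent \<mu> (\<lambda>x. exp (\<phi> x)) \<le>
               enn2ereal (\<integral>\<^sup>+ x. ennreal (H (c * deriv \<phi> x) * exp (\<phi> x)) \<partial>\<mu>)"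
      using c by blast
  qed
qed

end
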